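(* Let $\rightsquigarrow$ be a 3-eternal relation, $G$ a finite group, $p$ a prime divisor of $|G|$, and $S$ a Sylow $p$-subgroup of $G$. Suppose that there exists a subgroup $D$ of $S$ with $1<|D|<|S|$ such that every subgroup of $S$ of order $|D|$ or $p|D|$ is abelian, every subgroup $H$ of $S$ of order $|D|$ satisfies $H\rightsquigarrow G$, and, if $S$ is non-abelian and $p=2$, every cyclic subgroup $H$ of $S$ of order $4$ satisfies $H\rightsquigarrow G$. Then $\mathcal{F}_S(G)$ is supersolvable.
   Context: All groups are finite. $Z_{\mathfrak{U}}(G)$ denotes the supersolvable hypercenter of $G$: the largest normal subgroup $N$ of $G$ such that every chief factor of $G$ below $N$ is cyclic (of prime order). Let $\rightsquigarrow$ be a relation, defined for every finite group $G$, between subgroups $H\le G$ and $G$ (written $H\rightsquigarrow G$). It is called 3-eternal if for every finite group $G$ the following hold: (0) for all subgroups $H\le K\le G$, if $H\rightsquigarrow G$ then $H\rightsquigarrow K$; (3) for every prime divisor $p$ of $|G|$: if there exists a subgroup $D$ of $O_p(G)$ with $1<|D|<|O_p(G)|$ such that every subgroup $H$ of $O_p(G)$ of order $|D|$ satisfies $H\rightsquigarrow G$ and, in case $O_p(G)$ is non-abelian and $p=2$, every cyclic subgroup $H$ of $O_p(G)$ of order $4$ satisfies $H\rightsquigarrow G$, then $O_p(G)\le Z_{\mathfrak{U}}(G)$. $\mathcal{F}_S(G)$ is the (saturated) fusion system on $S\in\mathrm{Syl}_p(G)$ whose objects are the subgroups of $S$ and whose morphisms $P\to Q$ are the maps $x\mapsto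 x^g$ with $g\in G$, $P^g\le Q$. A saturated fusion system $\mathcal{F}$ on a $p$-group $S$ is supersolvable if there is a series $1=S_0\le S_1\le\cdots\le S_n=S$ of strongly $\mathcal{F}$-closed subgroups of $S$ with $S_{i+1}/S_i$ cyclic for $0\le i\le n-1$. (A subgroup $T\le S$ is strongly $\mathcal{F}$-closed if for every $P\le T$ and every $\phi\in\mathrm{Hom}_{\mathcal{F}}(P,S)$ one has $P^{\phi}\le T$.) *)

theory Defs
  imports "HOL-Algebra.Algebra"
begin

definition p_subgroup :: "nat \<Rightarrow> 'a monoid \<Rightarrow> 'a set \<Rightarrow> bool"
  where "p_subgroup p G P \<longleftrightarrow> subgroup P G \<and> (\<exists>n. card P = p ^ n)"

definition sylow_subgroup :: "nat \<Rightarrow> 'a monoid \<Rightarrow> 'a set \<Rightarrow> bool"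
  where "sylow_subgroup p G S \<longleftrightarrow> subgroup S G \<and> card S = p ^ multiplicity p (order G)"

definition cyclic_subgroup :: "'a monoid \<Rightarrow> 'a set \<Rightarrow> bool"
  where "cyclic_subgroup G H \<longleftrightarrow> subgroup H G \<and> cyclic_group (G\<lparr>carrier := H\<rparr>)"

(* O_p(G): the largest normal p-subgroup with respect to inclusion, which exists when G is finite
   and p is prime. *)
definition p_core :: "nat \<Rightarrow> 'a monoid \<Rightarrow> 'a set"
  where "p_core p G = (GREATEST N. N \<lhd> G \<and> p_subgroup p G N)"

(* H / K is a chief factor of G. *)
definition chief_factor :: "'a monoid \<Rightarrow> 'a set \<Rightarrow> 'a set \<Rightarrow> bool"
  where "chief_factor G H K \<longleftrightarrow> H \<lhd> G \<and> K \<lhd> G \<and> K \<subset> H \<and>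
    (\<forall>N. N \<lhd> G \<and> K \<subseteq> N \<and> N \<subseteq> H \<longrightarrow> N = K \<or> N = H)"

(* Z_U(G). The largest such N exists when G is finite: a chief factor below a product M N
   of two normal subgroups is isomorphic to a chief factor below M or below N. *)
definition supersolvable_hypercenter :: "'a monoid \<Rightarrow> 'a set"
  where "supersolvable_hypercenter G = (GREATEST N. N \<lhd> G \<and>
    (\<forall>H K. chief_factor G H K \<and> H \<subseteq> N \<longrightarrow> cyclic_group ((G\<lparr>carrier := H\<rparr>) Mod K)))"

(* R H G renders H \<leadsto> G. The groups in question are those with a finite carrier contained in the
   type 'a, the subgroup K of G being the group G\<lparr>carrier := K\<rparr>. Both clauses involve only G and
   subgroups of G, so that no group outside the type 'a is needed. *)
definition three_eternal :: "('a set \<Rightarrow> 'a monoid \<Rightarrow> bool) \<Rightarrow> bool"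
  where "three_eternal R \<longleftrightarrow> (\<forall>G. group G \<and> finite (carrier G) \<longrightarrow>
    (\<forall>H K. subgroup K G \<and> subgroup H (G\<lparr>carrier := K\<rparr>) \<and> R H G \<longrightarrow> R H (G\<lparr>carrier := K\<rparr>)) \<and>
    (\<forall>p. Factorial_Ring.prime p \<and> p dvd order G \<and>
      (\<exists>D. subgroup D (G\<lparr>carrier := p_core p G\<rparr>) \<and> 1 < card D \<and> card D < card (p_core p G) \<and>
        (\<forall>H. subgroup H (G\<lparr>carrier := p_core p G\<rparr>) \<and> card H = card D \<longrightarrow> R H G) \<and>
        (\<not> comm_group (G\<lparr>carrier := p_core p G\<rparr>) \<and> p = 2 \<longrightarrow>
          (\<forall>H. cyclic_subgroup (G\<lparr>carrier := p_core p G\<rparr>) H \<and> card H = 4 \<longrightarrow> R H G)))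
      \<longrightarrow> p_core p G \<subseteq> supersolvable_hypercenter G))"

(* A fusion system on a group S is given by its morphism sets: F P Q = Hom_F(P, Q) for subgroups
   P and Q of S, a morphism being a function extended by undefined outside P. *)
type_synonym 'a fusion = "'a set \<Rightarrow> 'a set \<Rightarrow> ('a \<Rightarrow> 'a) set"

(* F_S(G), with the convention x^g = g^(-1) x g. *)
definition group_fusion :: "'a monoid \<Rightarrow> 'a set \<Rightarrow> 'a fusion"
  where "group_fusion G S P Q =
    {\<phi>. subgroup P (G\<lparr>carrier := S\<rparr>) \<and> subgroup Q (G\<lparr>carrier := S\<rparr>) \<and>
      (\<exists>g \<in> carrier G. \<phi> = (\<lambda>x\<in>P. inv\<^bsub>G\<^esub> g \<otimes>\<^bsub>G\<^esub> x \<otimes>\<^bsub>G\<^esub> g) \<and> \<phi> ` P \<subseteq> Q)}"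

definition strongly_closed :: "'a monoid \<Rightarrow> 'a fusion \<Rightarrow> 'a set \<Rightarrow> bool"
  where "strongly_closed S F T \<longleftrightarrow> subgroup T S \<and>
    (\<forall>P \<phi>. subgroup P (S\<lparr>carrier := T\<rparr>) \<and> \<phi> \<in> F P (carrier S) \<longrightarrow> \<phi> ` P \<subseteq> T)"

(* Meant for a saturated fusion system F on S, such as F_S(G) for a Sylow subgroup S of G;
   the conjugations by elements of S then belong to F, which makes each T i normal in S. *)
definition supersolvable_fusion :: "'a monoid \<Rightarrow> 'a fusion \<Rightarrow> bool"
  where "supersolvable_fusion S F \<longleftrightarrow> (\<exists>(n::nat) T. T 0 = {\<one>\<^bsub>S\<^esub>} \<and> T n = carrier S \<and>
    (\<forall>i\<le>n. strongly_closed S F (T i)) \<and>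
    (\<forall>i<n. T i \<subseteq> T (Suc i) \<and> cyclic_group ((S\<lparr>carrier := T (Suc i)\<rparr>) Mod T i)))"

end

theory Submission
  imports Defs
begin

text \<open>
  Put \<open>N = N\<^sub>G(S)\<close>. It suffices that \<open>N\<close> controls the fusion of \<open>G\<close> in \<open>S\<close>: then every normal subgroup of
  \<open>N\<close> inside \<open>S\<close> is strongly closed, and since \<open>S = O\<^sub>p(N)\<close> lies in \<open>Z\<^sub>U(N)\<close> by clause (3), a chief
  series of \<open>N\<close> below \<open>S\<close> has cyclic factors.

  Control is shown by downward induction on \<open>P \<le> S\<close>. One may take \<open>P\<close> fully normalized, and then has to
  write each element of \<open>M = N\<^sub>G(P)\<close> as a product of an element of \<open>C\<^sub>G(P)\<close> and one that normalizes some
  larger \<open>U \<le> S\<close>. By the Frattini argument this holds with \<open>U = S \<inter> K\<close> for each \<open>K \<lhd> M\<close> with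
  \<open>K = C\<^sub>G(P) (S \<inter> K)\<close>. If \<open>|P| \<le> |D|\<close>, then \<open>P\<close> is properly contained in an abelian subgroup of \<open>S\<close> of
  order \<open>p|D|\<close>, and \<open>K = C\<^sub>G(P) P\<close> gives a larger \<open>U\<close>. If \<open>|P| > |D|\<close>, clauses (0) and (3) put \<open>P \<le> O\<^sub>p(M)\<close> into \<open>Z\<^sub>U(M)\<close>;
  let \<open>K\<close> be the subgroup of \<open>M\<close> that centralizes every chief factor of \<open>M\<close> below \<open>P\<close>. These factors have
  order \<open>p\<close>, so \<open>N\<^sub>S(P) \<le> K\<close>, while elements of \<open>K\<close> of order prime to \<open>p\<close> centralize \<open>P\<close>; hence
  \<open>K = C\<^sub>G(P) N\<^sub>S(P)\<close>.
\<close>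

section \<open>Actions of p-groups, conjugation and Sylow subgroups\<close>

text \<open>Elements of \<open>Bij E\<close> are extensional, hence the \<open>restrict\<close>. The
  action laws alone give bijectivity, since \<open>act (inv g)\<close> inverts
  \<open>act g\<close>.\<close>

lemma group_actionI:
  fixes G (structure)
  assumes "group G"
    and closed: "\<And>g x. g \<in> carrier G \<Longrightarrow> x \<in> E \<Longrightarrow> act g x \<in> E"
    and one: "\<And>x. x \<in> E \<Longrightarrow> act \<one> x = x"
    and mult: "\<And>g h x. g \<in> carrier G \<Longrightarrow> h \<in> carrier G \<Longrightarrow> x \<in> E \<Longrightarrow>
      act (g \<otimes> h) x = act g (act h x)"
  shows "group_action G E (\<lambda>g. restrict (act g) E)"
proof -
  interpret group G by fact
  have bij: "restrict (act g) E \<in> Bij E" if g: "g \<in> carrier G" for g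
  proof -
    have "bij_betw (act g) E E"
      by (rule bij_betwI[where g = "act (inv g)"])
        (use g closed one mult[of "inv g" g] mult[of g "inv g"] in auto)
    then show ?thesis by (simp add: Bij_def)
  qed
  have "restrict (act (g \<otimes> h)) E = compose E (restrict (act g) E) (restrict (act h) E)"
    if "g \<in> carrier G" "h \<in> carrier G" for g h
    using that closed mult by (auto simp: compose_def)
  then have "(\<lambda>g. restrict (act g) E) \<in> hom G (BijGroup E)"
    using bij by (auto simp: hom_def BijGroup_def)
  then show ?thesis
    by (simp add: group_action_def group_hom_def group_hom_axioms_def group_BijGroup assms)
qed

text \<open>The moved points are a disjoint union of orbits whose lengths are powers of
  \<open>p\<close> other than 1. Counting moved points turns the usual congruence between |E| and
  the number of fixed points into one divisibility.\<close>

lemma (in group_action) prime_dvd_card_moved_points: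
  assumes "finite E" and p: "Factorial_Ring.prime p" and ord: "order G = p ^ n"
  shows "p dvd card {x \<in> E. \<exists>g\<in>carrier G. \<phi> g x \<noteq> x}" (is "_ dvd card ?M")
proof -
  interpret group G using group_hom group_hom.axioms(1) by auto
  have orbE: "orbit G \<phi> x \<subseteq> E" if "x \<in> E" for x
    using that element_image by (auto simp: orbit_def)
  \<comment> \<open>A fixed point in the orbit of \<open>x\<close> equals \<open>x\<close>; hence
    the orbit of a moved point consists of moved points.\<close>
  have fixed: "\<phi> g y = y \<Longrightarrow> g \<in> carrier G \<Longrightarrow> y = x"
    if "x \<in> E" "y \<in> orbit G \<phi> x" "\<forall>g\<in>carrier G. \<phi> g y = y" for x y g
  proof -
    have "x \<in> orbit G \<phi> y" using that orbE orbit_sym by blast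
    then show ?thesis using that by (auto simp: orbit_def)
  qed
  let ?C = "orbit G \<phi> ` ?M"
  have un: "\<Union>?C = ?M"
  proof
    show "?M \<subseteq> \<Union>?C" using orbit_refl by blast
    show "\<Union>?C \<subseteq> ?M"
    proof
      fix y assume "y \<in> \<Union>?C"
      then obtain x where x: "x \<in> E" "\<exists>g\<in>carrier G. \<phi> g x \<noteq> x" "y \<in> orbit G \<phi> x" by blast
      have "y \<in> E" using orbE x by blast
      moreover have "\<exists>g\<in>carrier G. \<phi> g y \<noteq> y"
        using fixed[of x y] x one_closed by blast
      ultimately show "y \<in> ?M" by blast
    qed
  qed
  have "p dvd card c" if c: "c \<in> ?C" for c
  proof -
    obtain x where x: "x \<in> E" "\<exists>g\<in>carrier G. \<phi> g x \<noteq> x" "c = orbit G \<phi> x"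
      using c by blast
    have "card c * card (stabilizer G \<phi> x) = p ^ n"
      using orbit_stabilizer_theorem[of x] x ord by simp
    then obtain k where k: "card c = p ^ k"
      by (metis divides_primepow_nat dvd_triv_left p)
    have fin: "finite c" using x orbE assms(1) finite_subset by blast
    obtain g where g: "g \<in> carrier G" "\<phi> g x \<noteq> x" using x by blast
    have "{x, \<phi> g x} \<subseteq> c" using x g orbit_refl by (auto simp: orbit_def)
    then have "card {x, \<phi> g x} \<le> card c" by (rule card_mono[OF fin])
    then have "card c \<noteq> 1" using g by auto
    then show ?thesis using k by (cases k) auto
  qed
  moreover have "orbit G \<phi> x = orbit G \<phi> y"
    if "x \<in> E" "y \<in> E" "orbit G \<phi> x \<inter> orbit G \<phi> y \<noteq> {}" for x y
    using disjoint_union[of "orbit G \<phi> x" "orbit G \<phi> y"] that by (auto simp: orbits_def)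
  moreover have "finite (\<Union>?C)" unfolding un using assms(1) by simp
  ultimately have "p dvd card (\<Union>?C)"
    by (intro dvd_partition) blast+
  then show ?thesis by (simp add: un)
qed

section \<open>Conjugation, normalizers and centralizers\<close>

definition conjug :: "('a, 'b) monoid_scheme \<Rightarrow> 'a \<Rightarrow> 'a \<Rightarrow> 'a"
  where "conjug G g x = inv\<^bsub>G\<^esub> g \<otimes>\<^bsub>G\<^esub> x \<otimes>\<^bsub>G\<^esub> g"

definition set_normalizer :: "('a, 'b) monoid_scheme \<Rightarrow> 'a set \<Rightarrow> 'a set"
  where "set_normalizer G P = {g \<in> carrier G. conjug G g ` P = P}"

definition set_centralizer :: "('a, 'b) monoid_scheme \<Rightarrow> 'a set \<Rightarrow> 'a set"
  where "set_centralizer G P = {g \<in> carrier G. \<forall>x\<in>P. conjug G g x = x}"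

context group
begin

lemma conjug_closed [simp]:
  "g \<in> carrier G \<Longrightarrow> x \<in> carrier G \<Longrightarrow> conjug G g x \<in> carrier G"
  by (simp add: conjug_def)

text \<open>With x^g = g^-1 x g, the convention of \<open>group_fusion\<close>, conjugation is a
  right action: hence the reversed order here, and the inverses wherever a left action is formed
  from it.\<close>

lemma conjug_mult:
  "g \<in> carrier G \<Longrightarrow> h \<in> carrier G \<Longrightarrow> x \<in> carrier G \<Longrightarrow>
    conjug G (g \<otimes> h) x = conjug G h (conjug G g x)"
  by (simp add: conjug_def inv_mult_group m_assoc)

lemma conjug_one [simp]: "x \<in> carrier G \<Longrightarrow> conjug G \<one> x = x"
  by (simp add: conjug_def)

lemma conjug_hom:
  "g \<in> carrier G \<Longrightarrow> x \<in> carrier G \<Longrightarrow> y \<in> carrier G \<Longrightarrow>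
    conjug G g (x \<otimes> y) = conjug G g x \<otimes> conjug G g y"
  by (simp add: conjug_def m_assoc inv_solve_left flip: m_assoc[of g "inv g"])

lemma conjug_one_right [simp]: "g \<in> carrier G \<Longrightarrow> conjug G g \<one> = \<one>"
  by (simp add: conjug_def)

lemma conjug_inv_right:
  "g \<in> carrier G \<Longrightarrow> x \<in> carrier G \<Longrightarrow> conjug G g (inv x) = inv (conjug G g x)"
  by (simp add: conjug_def inv_mult_group m_assoc)

lemma conjug_conjug_inv [simp]:
  "g \<in> carrier G \<Longrightarrow> x \<in> carrier G \<Longrightarrow> conjug G g (conjug G (inv g) x) = x"
  "g \<in> carrier G \<Longrightarrow> x \<in> carrier G \<Longrightarrow> conjug G (inv g) (conjug G g x) = x"
  by (simp_all flip: conjug_mult)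

lemma conjug_eq_iff:
  "g \<in> carrier G \<Longrightarrow> x \<in> carrier G \<Longrightarrow> conjug G g x = x \<longleftrightarrow> g \<otimes> x = x \<otimes> g"
  unfolding conjug_def by (metis inv_solve_left m_assoc m_closed inv_closed)

lemma inj_on_conjug: "g \<in> carrier G \<Longrightarrow> Y \<subseteq> carrier G \<Longrightarrow> inj_on (conjug G g) Y"
  by (rule inj_on_inverseI[where g = "conjug G (inv g)"]) auto

lemma card_conjug_image: "g \<in> carrier G \<Longrightarrow> Y \<subseteq> carrier G \<Longrightarrow> card (conjug G g ` Y) = card Y"
  by (simp add: card_image inj_on_conjug)

lemma conjug_image_mult:
  "g \<in> carrier G \<Longrightarrow> h \<in> carrier G \<Longrightarrow> Y \<subseteq> carrier G \<Longrightarrow>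
    conjug G (g \<otimes> h) ` Y = conjug G h ` conjug G g ` Y"
  unfolding image_image by (rule image_cong) (auto intro: conjug_mult)

lemma conjug_image_inv:
  "g \<in> carrier G \<Longrightarrow> Y \<subseteq> carrier G \<Longrightarrow> conjug G g ` Y = Z \<Longrightarrow> conjug G (inv g) ` Z = Y"
  by (auto simp: image_image subset_iff image_iff)

lemma subgroup_conjug_image:
  assumes "subgroup H G" "g \<in> carrier G"
  shows "subgroup (conjug G g ` H) G"
proof -
  interpret H: subgroup H G by fact
  show ?thesis
  proof (rule subgroupI)
    show "conjug G g ` H \<subseteq> carrier G" using assms H.subset by auto
    show "conjug G g ` H \<noteq> {}" using H.one_closed by blast
    show "inv a \<in> conjug G g ` H" if "a \<in> conjug G g ` H" for a
      using that assms H.m_inv_closed by (auto simp flip: conjug_inv_right)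
    show "a \<otimes> b \<in> conjug G g ` H" if "a \<in> conjug G g ` H" "b \<in> conjug G g ` H" for a b
      using that assms H.m_closed by (auto simp flip: conjug_hom)
  qed
qed

lemma subgroup_set_normalizer:
  assumes "P \<subseteq> carrier G"
  shows "subgroup (set_normalizer G P) G"
proof (rule subgroupI)
  show "set_normalizer G P \<noteq> {}"
  proof -
    have "conjug G \<one> ` P = P" using assms by (simp add: subset_iff)
    then show ?thesis by (auto simp: set_normalizer_def)
  qed
qed (use assms in \<open>auto simp: set_normalizer_def conjug_image_mult conjug_image_inv\<close>)

lemma subgroup_subset_set_normalizer:
  assumes "subgroup P G"
  shows "P \<subseteq> set_normalizer G P"
proof -
  interpret P: subgroup P G by fact
  have "conjug G x ` P = P" if x: "x \<in> P" for x
  proof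
    show "conjug G x ` P \<subseteq> P" using x by (auto simp: conjug_def)
    show "P \<subseteq> conjug G x ` P"
    proof
      fix y assume y: "y \<in> P"
      then have "conjug G (inv x) y \<in> P" using x by (simp add: conjug_def)
      then show "y \<in> conjug G x ` P"
        using x y by (intro image_eqI[of _ _ "conjug G (inv x) y"]) auto
    qed
  qed
  then show ?thesis using P.subset by (auto simp: set_normalizer_def)
qed

lemma subgroup_set_centralizer:
  assumes "P \<subseteq> carrier G"
  shows "subgroup (set_centralizer G P) G"
proof (rule subgroupI)
  show "set_centralizer G P \<noteq> {}"
    using assms by (auto simp: set_centralizer_def intro!: exI[of _ \<one>])
  show "inv a \<in> set_centralizer G P" if "a \<in> set_centralizer G P" for a
    using that assms by (auto simp: set_centralizer_def subset_iff) (metis conjug_conjug_inv(2))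
qed (use assms in \<open>auto simp: set_centralizer_def conjug_mult subset_iff\<close>)

lemma normal_iff_conjug:
  "N \<lhd> G \<longleftrightarrow> subgroup N G \<and> (\<forall>g\<in>carrier G. \<forall>x\<in>N. conjug G g x \<in> N)"
proof (intro iffI conjI ballI)
  assume N: "N \<lhd> G"
  show "subgroup N G" using N by (rule normal_imp_subgroup)
  show "conjug G g x \<in> N" if "g \<in> carrier G" "x \<in> N" for g x
    using normal.inv_op_closed1[OF N] that by (simp add: conjug_def)
next
  assume N: "subgroup N G \<and> (\<forall>g\<in>carrier G. \<forall>x\<in>N. conjug G g x \<in> N)"
  show "N \<lhd> G"
  proof (rule normal_invI)
    show "x \<otimes> h \<otimes> inv x \<in> N" if "x \<in> carrier G" "h \<in> N" for x h
      using N that by (metis conjug_def inv_closed inv_inv)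
  qed (use N in simp)
qed

lemma normal_conjug_image:
  assumes "N \<lhd> G" "g \<in> carrier G"
  shows "conjug G g ` N = N"
proof -
  have N: "N \<subseteq> carrier G" "\<And>g x. g \<in> carrier G \<Longrightarrow> x \<in> N \<Longrightarrow> conjug G g x \<in> N"
    using assms(1) subgroup.subset by (auto simp: normal_iff_conjug)
  have "x \<in> conjug G g ` N" if "x \<in> N" for x
    using N that assms(2) by (intro image_eqI[of _ _ "conjug G (inv g) x"]) auto
  then show ?thesis using N assms(2) by auto
qed

lemma normal_set_normalizer_iff:
  assumes "subgroup N G"
  shows "N \<lhd> G \<longleftrightarrow> set_normalizer G N = carrier G"
  using assms normal_conjug_image[of N] by (auto simp: set_normalizer_def normal_iff_conjug)

text \<open>Conjugation by g^-1 c g is conjugation by g^-1, then by c, then by g; the middle one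
  acts on an element of \<open>P\<close> and fixes it.\<close>

lemma normal_set_centralizer:
  assumes "P \<lhd> G"
  shows "set_centralizer G P \<lhd> G"
  unfolding normal_iff_conjug
proof (intro conjI ballI)
  have P: "P \<subseteq> carrier G" using assms normal_imp_subgroup subgroup.subset by blast
  then show "subgroup (set_centralizer G P) G" by (rule subgroup_set_centralizer)
  fix g c assume g: "g \<in> carrier G" and c: "c \<in> set_centralizer G P"
  then have c': "c \<in> carrier G" by (simp add: set_centralizer_def)
  have "conjug G (conjug G g c) x = x" if x: "x \<in> P" for x
  proof -
    have "conjug G (inv g) x \<in> P" using assms g x by (auto simp: normal_iff_conjug)
    then have "conjug G c (conjug G (inv g) x) = conjug G (inv g) x"
      using c by (simp add: set_centralizer_def)
    moreover have "conjug G (conjug G g c) x = conjug G g (conjug G c (conjug G (inv g) x))"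
      using g c' x P by (simp add: conjug_def[of G g c] conjug_mult subset_iff)
    ultimately show ?thesis using g x P by auto
  qed
  then show "conjug G g c \<in> set_centralizer G P"
    using g c' by (simp add: set_centralizer_def)
qed

lemma conjug_restrict:
  assumes "subgroup M G" "g \<in> M"
  shows "conjug (G\<lparr>carrier := M\<rparr>) g = conjug G g"
  using assms by (simp add: conjug_def fun_eq_iff)

text \<open>\<open>Q\<close> permutes the right cosets of \<open>S\<close> by right multiplication,
  which the inverse turns into a left action. Both the conjugacy of Sylow subgroups and the growth
  of normalizers come from this count.\<close>

lemma coset_fixed_points:
  assumes fin: "finite (carrier G)" and p: "Factorial_Ring.prime p"
    and Q: "subgroup Q G" "card Q = p ^ n" and S: "subgroup S G"
  shows "p dvd card {Y \<in> rcosets S. \<exists>q\<in>Q. Y #> q \<noteq> Y}"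
proof -
  interpret Q: subgroup Q G by fact
  have closed: "Y #> g \<in> rcosets S" if "g \<in> carrier G" "Y \<in> rcosets S" for g Y
    using that S subgroup.subset[OF S] by (auto simp: RCOSETS_def coset_mult_assoc)
  have sub: "Y \<subseteq> carrier G" if "Y \<in> rcosets S" for Y
    using that S subgroup.rcosets_carrier is_group by blast
  have "group_action (G\<lparr>carrier := Q\<rparr>) (rcosets S) (\<lambda>g. restrict (\<lambda>Y. Y #> inv g) (rcosets S))"
  proof (rule group_actionI)
    show "group (G\<lparr>carrier := Q\<rparr>)" using Q subgroup_imp_group by blast
    show "Y #> inv (g \<otimes>\<^bsub>G\<lparr>carrier := Q\<rparr>\<^esub> h) = Y #> inv h #> inv g"
      if "g \<in> carrier (G\<lparr>carrier := Q\<rparr>)" "h \<in> carrier (G\<lparr>carrier := Q\<rparr>)" "Y \<in> rcosets S" for g h Y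
      using that sub by (simp add: inv_mult_group coset_mult_assoc)
  qed (use closed sub in auto)
  then have "p dvd card {Y \<in> rcosets S. \<exists>g\<in>carrier (G\<lparr>carrier := Q\<rparr>).
      restrict (\<lambda>Y. Y #> inv g) (rcosets S) Y \<noteq> Y}"
    by (rule group_action.prime_dvd_card_moved_points)
      (use fin p Q S in \<open>auto simp: order_def RCOSETS_def\<close>)
  also have "{Y \<in> rcosets S. \<exists>g\<in>carrier (G\<lparr>carrier := Q\<rparr>).
      restrict (\<lambda>Y. Y #> inv g) (rcosets S) Y \<noteq> Y} = {Y \<in> rcosets S. \<exists>q\<in>Q. Y #> q \<noteq> Y}"
    by auto (metis Q.m_inv_closed Q.mem_carrier inv_inv)+
  finally show ?thesis .
qed

text \<open>If S g q = S g, then g q lies in S g, that is, g q g^-1 lies in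
  \<open>S\<close>.\<close>

lemma coset_fixed_conjug:
  assumes S: "subgroup S G" and Q: "Q \<subseteq> carrier G" and g: "g \<in> carrier G"
    and fixed: "\<forall>q\<in>Q. S #> g #> q = S #> g"
  shows "conjug G (inv g) ` Q \<subseteq> S"
proof
  fix y assume "y \<in> conjug G (inv g) ` Q"
  then obtain q where q: "q \<in> Q" "y = g \<otimes> q \<otimes> inv g" "q \<in> carrier G"
    using g Q by (auto simp: conjug_def)
  have "S #> (g \<otimes> q) = S #> g #> q"
    using q g subgroup.subset[OF S] by (simp add: coset_mult_assoc)
  also have "\<dots> = S #> g" using fixed q by blast
  finally have "S #> (g \<otimes> q) = S #> g" .
  then have "g \<otimes> q \<in> S #> g" using rcos_self[OF _ S] g q by (metis m_closed)
  then obtain s where "s \<in> S" "g \<otimes> q = s \<otimes> g" by (auto simp: r_coset_def)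
  then show "y \<in> S" using q g subgroup.mem_carrier[OF S] by (simp add: m_assoc)
qed

lemma card_subgroup_dvd:
  assumes "subgroup H G" "subgroup K G" "H \<subseteq> K"
  shows "card H dvd card K"
proof -
  have "card (rcosets\<^bsub>G\<lparr>carrier := K\<rparr>\<^esub> H) * card H = card K"
    using group.lagrange[OF subgroup_imp_group[OF assms(2)] subgroup_incl[OF assms]]
    by (simp add: order_def)
  then show ?thesis by (metis dvd_triv_right)
qed

end

section \<open>Conjugacy of Sylow subgroups and growth of normalizers\<close>

locale finite_group = group G for G :: "'a monoid" (structure) +
  assumes fin: "finite (carrier G)"
begin

lemma sylow_index_not_dvd:
  assumes "Factorial_Ring.prime p" "sylow_subgroup p G S"
  shows "\<not> p dvd card (rcosets S)"
proof
  assume "p dvd card (rcosets S)"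
  moreover have S: "card (rcosets S) * p ^ multiplicity p (order G) = order G"
    using lagrange[of S] assms(2) by (simp add: sylow_subgroup_def)
  ultimately have "p ^ Suc (multiplicity p (order G)) dvd order G"
    by (metis mult_dvd_mono dvd_refl power_Suc)
  moreover have "order G \<noteq> 0" using fin order_gt_0_iff_finite by simp
  ultimately show False
    using assms(1) by (metis Suc_n_not_le_n not_prime_unit power_dvd_iff_le_multiplicity)
qed

text \<open>The number of cosets of \<open>S\<close> moved by \<open>Q\<close> is divisible by
  \<open>p\<close>, the number of all cosets is not; so \<open>Q\<close> fixes a coset S g, and g^-1
  conjugates \<open>Q\<close> into \<open>S\<close>.\<close>

lemma sylow_conjug:
  assumes p: "Factorial_Ring.prime p"
    and Q: "p_subgroup p G Q" and S: "sylow_subgroup p G S"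
  shows "\<exists>g\<in>carrier G. conjug G g ` Q \<subseteq> S"
proof -
  obtain n where Q': "subgroup Q G" "card Q = p ^ n" using Q by (auto simp: p_subgroup_def)
  have S': "subgroup S G" using S by (simp add: sylow_subgroup_def)
  have "{Y \<in> rcosets S. \<exists>q\<in>Q. Y #> q \<noteq> Y} \<noteq> rcosets S"
    using coset_fixed_points[OF fin p Q' S'] sylow_index_not_dvd[OF p S] by auto
  then obtain Y where Y: "Y \<in> rcosets S" "\<forall>q\<in>Q. Y #> q = Y" by blast
  then obtain g where g: "g \<in> carrier G" "Y = S #> g" by (auto simp: RCOSETS_def)
  then show ?thesis
    using coset_fixed_conjug[OF S' subgroup.subset[OF Q'(1)] g(1)] Y by blast
qed

text \<open>\<open>P\<close> acts on its own cosets. Their number and the number of moved ones are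
  divisible by \<open>p\<close>, hence so is the number of fixed ones. As the coset \<open>P\<close>
  is fixed, so is another coset P g, and g^-1 normalizes \<open>P\<close> without lying in
  it.\<close>

lemma p_group_normalizer_grows:
  assumes p: "Factorial_Ring.prime p"
    and ord: "order G = p ^ n" and P: "subgroup P G" "P \<noteq> carrier G"
  shows "P \<subset> set_normalizer G P"
proof -
  interpret P: subgroup P G by fact
  have idx: "card (rcosets P) * card P = p ^ n" using lagrange[OF P(1)] ord by simp
  then obtain a b where ab: "card P = p ^ a" "card (rcosets P) = p ^ b"
    by (metis divides_primepow_nat dvd_triv_left dvd_triv_right p)
  have "card P \<noteq> p ^ n"
    using P ord fin by (metis P.subset card_subset_eq order_def)
  then have "b \<noteq> 0" using idx ab by (cases b) auto
  then have dvd: "p dvd card (rcosets P)" using ab by simp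
  let ?F = "{Y \<in> rcosets P. \<forall>q\<in>P. Y #> q = Y}"
  have finR: "finite (rcosets P)" using fin by (simp add: RCOSETS_def)
  have "rcosets P - ?F = {Y \<in> rcosets P. \<exists>q\<in>P. Y #> q \<noteq> Y}" by blast
  then have "p dvd card (rcosets P - ?F)"
    using coset_fixed_points[OF fin p P(1) ab(1) P(1)] by simp
  moreover have F: "?F \<subseteq> rcosets P" by blast
  have "card (rcosets P - ?F) + card ?F = card (rcosets P)"
    using finR card_mono[OF finR F] by (simp add: card_Diff_subset[OF finite_subset[OF F finR] F])
  ultimately have dvdF: "p dvd card ?F"
    using dvd_add_right_iff[of p "card (rcosets P - ?F)" "card ?F"] dvd by simp
  have PF: "P \<in> ?F"
    using P.rcos_const is_group subgroup.subgroup_in_rcosets[OF P(1) is_group] by auto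
  have "?F \<noteq> {P}"
  proof
    assume "?F = {P}"
    then have "p dvd 1" using dvdF by simp
    then show False using p by (simp add: prime_nat_iff)
  qed
  then obtain Y where Y: "Y \<in> rcosets P" "\<forall>q\<in>P. Y #> q = Y" "Y \<noteq> P" using PF by blast
  then obtain g where g: "g \<in> carrier G" "Y = P #> g" by (auto simp: RCOSETS_def)
  have "conjug G (inv g) ` P \<subseteq> P"
    using coset_fixed_conjug[OF P(1) P.subset g(1)] Y g by blast
  moreover have "finite P" using fin P.subset finite_subset by blast
  ultimately have "conjug G (inv g) ` P = P"
    using card_conjug_image[of "inv g" P] g P.subset by (metis card_subset_eq inv_closed)
  then have "inv g \<in> set_normalizer G P" using g by (simp add: set_normalizer_def)
  moreover have "inv g \<notin> P"
    using Y(3) g P.rcos_const[OF is_group] by (metis P.m_inv_closed inv_inv)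
  moreover have "P \<subseteq> set_normalizer G P"
    using P(1) by (rule subgroup_subset_set_normalizer)
  ultimately show ?thesis by blast
qed

end

section \<open>Normal products and the Frattini argument\<close>

context group
begin

lemma set_normalizer_restrict:
  assumes "subgroup M G"
  shows "set_normalizer (G\<lparr>carrier := M\<rparr>) P = M \<inter> set_normalizer G P"
  using assms subgroup.subset[OF assms]
  by (auto simp: set_normalizer_def conjug_restrict)

lemma set_centralizer_restrict:
  assumes "subgroup M G"
  shows "set_centralizer (G\<lparr>carrier := M\<rparr>) P = M \<inter> set_centralizer G P"
  using assms subgroup.subset[OF assms]
  by (auto simp: set_centralizer_def conjug_restrict)

lemma subgroup_restrict_iff:
  assumes "subgroup M G"
  shows "subgroup H (G\<lparr>carrier := M\<rparr>) \<longleftrightarrow> subgroup H G \<and> H \<subseteq> M"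
proof
  assume H: "subgroup H (G\<lparr>carrier := M\<rparr>)"
  then show "subgroup H G \<and> H \<subseteq> M"
    using incl_subgroup[OF assms H] subgroup.subset[OF H] by simp
qed (use assms subgroup_incl in blast)

lemma normal_in_set_normalizer:
  assumes "subgroup P G"
  shows "P \<lhd> (G\<lparr>carrier := set_normalizer G P\<rparr>)"
proof -
  have N: "subgroup (set_normalizer G P) G"
    using assms subgroup.subset subgroup_set_normalizer by blast
  interpret N: group "G\<lparr>carrier := set_normalizer G P\<rparr>"
    using N by (rule subgroup_imp_group)
  have "subgroup P (G\<lparr>carrier := set_normalizer G P\<rparr>)"
    using assms N subgroup_subset_set_normalizer by (simp add: subgroup_restrict_iff)
  then show ?thesis
    using N by (simp add: N.normal_set_normalizer_iff set_normalizer_restrict)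
qed

lemma subgroup_normal_mult:
  assumes "C \<lhd> G" "subgroup H G"
  shows "subgroup (C <#> H) G" "C \<subseteq> C <#> H" "H \<subseteq> C <#> H"
proof -
  interpret second_isomorphism_grp C G H
    using assms by (simp add: second_isomorphism_grp_def second_isomorphism_grp_axioms_def)
  show "subgroup (C <#> H) G" "C \<subseteq> C <#> H" "H \<subseteq> C <#> H"
    by (rule normal_set_mult_subgroup H_contained_in_set_mult S_contained_in_set_mult)+
qed

lemma normal_set_mult:
  assumes "M \<lhd> G" "N \<lhd> G"
  shows "M <#> N \<lhd> G"
proof -
  have MN: "subgroup M G" "subgroup N G" using assms normal_imp_subgroup by auto
  have "conjug G g (x \<otimes> y) \<in> M <#> N" if "g \<in> carrier G" "x \<in> M" "y \<in> N" for g x y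
  proof -
    have "conjug G g (x \<otimes> y) = conjug G g x \<otimes> conjug G g y"
      using that MN subgroup.mem_carrier by (metis conjug_hom)
    then show ?thesis
      using that assms unfolding normal_iff_conjug set_mult_def by blast
  qed
  then show ?thesis
    unfolding normal_iff_conjug using subgroup_normal_mult[OF assms(1) MN(2)]
    by (auto simp: set_mult_def)
qed

lemma card_rcosets_restrict:
  assumes "subgroup K G" "subgroup H G" "K \<subseteq> H"
  shows "card (rcosets\<^bsub>G\<lparr>carrier := H\<rparr>\<^esub> K) * card K = card H"
  using group.lagrange[OF subgroup_imp_group[OF assms(2)] subgroup_incl[OF assms(1,2,3)]]
  by (simp add: order_def)

text \<open>By the second isomorphism theorem, \<open>K\<close> has the same index in KA as
  \<open>K \<inter> A\<close> has in \<open>A\<close>; Lagrange's theorem turns this into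
  orders.\<close>

lemma card_normal_mult:
  assumes "K \<lhd> G" "subgroup A G"
  shows "card (K <#> A) * card (K \<inter> A) = card K * card A"
proof -
  interpret second_isomorphism_grp K G A
    using assms by (simp add: second_isomorphism_grp_def second_isomorphism_grp_axioms_def)
  note sub = subgroup_normal_mult[OF assms]
  have K: "subgroup K G" using assms normal_imp_subgroup by blast
  have KA: "subgroup (K \<inter> A) G" using K assms(2) subgroups_Inter_pair by blast
  have "card (rcosets\<^bsub>G\<lparr>carrier := A\<rparr>\<^esub> (K \<inter> A)) = card (rcosets\<^bsub>G\<lparr>carrier := K <#> A\<rparr>\<^esub> K)"
    using iso_same_card[OF is_isoI[OF normal_intersection_quotient_isom]]
    by (simp add: FactGroup_def)
  moreover have "card (rcosets\<^bsub>G\<lparr>carrier := A\<rparr>\<^esub> (K \<inter> A)) * card (K \<inter> A) = card A"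
    using KA assms(2) by (simp add: card_rcosets_restrict)
  moreover have "card (rcosets\<^bsub>G\<lparr>carrier := K <#> A\<rparr>\<^esub> K) * card K = card (K <#> A)"
    using K sub by (simp add: card_rcosets_restrict)
  ultimately show ?thesis by (metis mult.assoc mult.commute)
qed

text \<open>Cauchy's theorem, taken as Sylow's theorem with exponent 1, gives a subgroup of order
  \<open>q\<close> in the quotient; the union of its cosets is its preimage.\<close>

lemma subgroup_of_prime_index_over_normal:
  assumes fin: "finite (carrier G)" and N: "N \<lhd> G" and q: "Factorial_Ring.prime q"
    and dvd: "q dvd card (rcosets N)"
  shows "\<exists>U. subgroup U G \<and> N \<subseteq> U \<and> card U = q * card N"
proof -
  interpret N: normal N G by fact
  have Ns: "subgroup N G" using N normal_imp_subgroup by blast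
  obtain m where "order (G Mod N) = q ^ 1 * m"
    using dvd by (auto simp: order_def FactGroup_def)
  moreover have "finite (carrier (G Mod N))" using fin by (simp add: FactGroup_def RCOSETS_def)
  ultimately obtain A where A: "subgroup A (G Mod N)" "card A = q"
    using sylow_thm[OF q N.factorgroup_is_group] by fastforce
  have U: "subgroup (\<Union>A) G" using A(1) by (rule N.factgroup_subgroup_union_subgroup)
  have NU: "N \<subseteq> \<Union>A" using subgroup.one_closed[OF A(1)] by auto
  have "card (rcosets\<^bsub>G\<lparr>carrier := \<Union>A\<rparr>\<^esub> N) = q"
    using A N.factgroup_subgroup_union_factor by metis
  then have "card (\<Union>A) = q * card N" using card_rcosets_restrict[OF Ns U NU] by simp
  then show ?thesis using U NU by blast
qed

end

context finite_group
begin

lemma finite_subgroup: "subgroup H G \<Longrightarrow> finite H"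
  using fin subgroup.subset finite_subset by metis

lemma card_subgroup_pos: "subgroup H G \<Longrightarrow> 0 < card H"
  using finite_subgroup subgroup.one_closed by (metis card_gt_0_iff empty_iff)

lemma finite_group_restrict: "subgroup M G \<Longrightarrow> finite_group (G\<lparr>carrier := M\<rparr>)"
  using subgroup_imp_group finite_subgroup
  by (simp add: finite_group_def finite_group_axioms_def)

lemma p_subgroup_subset:
  assumes "Factorial_Ring.prime p" "p_subgroup p G Q" "subgroup P G" "P \<subseteq> Q"
  shows "p_subgroup p G P"
proof -
  have "card P dvd card Q" using assms by (intro card_subgroup_dvd) (auto simp: p_subgroup_def)
  then show ?thesis
    using assms by (auto simp: p_subgroup_def divides_primepow_nat)
qed

lemma p_subgroup_restrict_iff:
  "subgroup M G \<Longrightarrow> p_subgroup p (G\<lparr>carrier := M\<rparr>) P \<longleftrightarrow> p_subgroup p G P \<and> P \<subseteq> M"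
  by (auto simp: p_subgroup_def subgroup_restrict_iff)

lemma p_subgroup_conjug_image:
  assumes "p_subgroup p G P" "g \<in> carrier G"
  shows "p_subgroup p G (conjug G g ` P)"
  using assms subgroup.subset[of P G]
  by (auto simp: p_subgroup_def subgroup_conjug_image card_conjug_image)

lemma sylow_imp_p_subgroup: "sylow_subgroup p G S \<Longrightarrow> p_subgroup p G S"
  by (auto simp: sylow_subgroup_def p_subgroup_def)

lemma p_subgroup_card_le:
  assumes "Factorial_Ring.prime p" "p_subgroup p G Q"
  shows "card Q \<le> p ^ multiplicity p (order G)"
proof -
  obtain n where n: "subgroup Q G" "card Q = p ^ n" using assms by (auto simp: p_subgroup_def)
  then have "p ^ n dvd order G" using lagrange[OF n(1)] by (metis dvd_triv_right)
  moreover have "order G \<noteq> 0" using fin order_gt_0_iff_finite by simp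
  ultimately have "n \<le> multiplicity p (order G)"
    using assms(1) by (metis not_prime_unit power_dvd_iff_le_multiplicity)
  then show ?thesis
    using n assms(1) prime_ge_1_nat[of p] power_increasing[of n _ p] by simp
qed

lemma sylow_maximal:
  assumes "Factorial_Ring.prime p" "sylow_subgroup p G S" "p_subgroup p G Q" "S \<subseteq> Q"
  shows "Q = S"
proof -
  have "finite Q" using assms(3) finite_subgroup by (auto simp: p_subgroup_def)
  then show ?thesis
    using p_subgroup_card_le[OF assms(1,3)] assms(2,4) card_mono card_subset_eq
    by (metis le_antisym sylow_subgroup_def)
qed

lemma sylow_exists:
  assumes "Factorial_Ring.prime p"
  shows "\<exists>S. sylow_subgroup p G S"
proof -
  have "order G = p ^ multiplicity p (order G) * (order G div p ^ multiplicity p (order G))"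
    by (simp add: multiplicity_dvd)
  then show ?thesis
    using sylow_thm[OF assms is_group _ fin] by (auto simp: sylow_subgroup_def)
qed

lemma sylow_above:
  assumes p: "Factorial_Ring.prime p" and Q: "p_subgroup p G Q"
  shows "\<exists>S. sylow_subgroup p G S \<and> Q \<subseteq> S"
proof -
  obtain S where S: "sylow_subgroup p G S" using sylow_exists[OF p] by blast
  then have S': "subgroup S G" by (simp add: sylow_subgroup_def)
  obtain g where g: "g \<in> carrier G" "conjug G g ` Q \<subseteq> S" using sylow_conjug[OF p Q S] by blast
  have "Q \<subseteq> carrier G" using Q subgroup.subset by (auto simp: p_subgroup_def)
  then have "Q \<subseteq> conjug G (inv g) ` S" using conjug_image_inv[OF g(1)] g(2) by blast
  moreover have "sylow_subgroup p G (conjug G (inv g) ` S)"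
    using S g subgroup.subset[OF S']
    by (simp add: sylow_subgroup_def subgroup_conjug_image card_conjug_image)
  ultimately show ?thesis by blast
qed

lemma normal_p_subgroup_subset_sylow:
  assumes "Factorial_Ring.prime p" "N \<lhd> G" "p_subgroup p G N" "sylow_subgroup p G S"
  shows "N \<subseteq> S"
  using sylow_conjug[OF assms(1,3,4)] normal_conjug_image[OF assms(2)] by auto

text \<open>A Sylow subgroup of \<open>K\<close> can be conjugated into \<open>V\<close>, and stays
  in \<open>K\<close> by normality. So the p-group \<open>V \<inter> K\<close> is at least as large
  as a Sylow subgroup of \<open>K\<close>.\<close>

lemma sylow_inter_normal:
  assumes p: "Factorial_Ring.prime p" and K: "K \<lhd> G" and V: "sylow_subgroup p G V"
  shows "sylow_subgroup p (G\<lparr>carrier := K\<rparr>) (V \<inter> K)"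
proof -
  have Ks: "subgroup K G" and Vs: "subgroup V G"
    using K V normal_imp_subgroup by (auto simp: sylow_subgroup_def)
  interpret K: finite_group "G\<lparr>carrier := K\<rparr>" using Ks by (rule finite_group_restrict)
  obtain Q where Q: "sylow_subgroup p (G\<lparr>carrier := K\<rparr>) Q" using K.sylow_exists[OF p] by blast
  then have "p_subgroup p G Q" and QK: "Q \<subseteq> K"
    using K.sylow_imp_p_subgroup p_subgroup_restrict_iff[OF Ks] by auto
  then obtain g where g: "g \<in> carrier G" "conjug G g ` Q \<subseteq> V" using sylow_conjug[OF p _ V] by blast
  have "conjug G g ` Q \<subseteq> K" using QK g K by (auto simp: normal_iff_conjug)
  moreover have VK: "subgroup (V \<inter> K) G" using Vs Ks subgroups_Inter_pair by blast
  ultimately have "card Q \<le> card (V \<inter> K)"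
    using g QK card_mono[OF finite_subgroup[OF VK], of "conjug G g ` Q"] subgroup.subset[OF Ks]
    by (simp add: card_conjug_image)
  moreover have pVK: "p_subgroup p (G\<lparr>carrier := K\<rparr>) (V \<inter> K)"
    using p_subgroup_subset[OF p sylow_imp_p_subgroup[OF V] VK] p_subgroup_restrict_iff[OF Ks]
    by simp
  ultimately show ?thesis
    using K.p_subgroup_card_le[OF p pVK] Q by (auto simp: sylow_subgroup_def p_subgroup_def)
qed

text \<open>Conjugation by \<open>g\<close> moves \<open>U\<close> to another p-subgroup of
  \<open>K\<close>, and some k in \<open>K\<close> moves it back; so g k normalizes
  \<open>U\<close>.\<close>

lemma frattini_argument:
  assumes p: "Factorial_Ring.prime p" and K: "K \<lhd> G"
    and U: "sylow_subgroup p (G\<lparr>carrier := K\<rparr>) U" and g: "g \<in> carrier G"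
  shows "\<exists>k\<in>K. \<exists>n\<in>set_normalizer G U. g = k \<otimes> n"
proof -
  have Ks: "subgroup K G" using K normal_imp_subgroup by blast
  interpret K: finite_group "G\<lparr>carrier := K\<rparr>" using Ks by (rule finite_group_restrict)
  have Up: "p_subgroup p G U" and UK: "U \<subseteq> K"
    using U K.sylow_imp_p_subgroup p_subgroup_restrict_iff[OF Ks] by auto
  then have Us: "subgroup U G" by (simp add: p_subgroup_def)
  have UG: "U \<subseteq> carrier G" using Us subgroup.subset by blast
  have "conjug G g ` U \<subseteq> K" using UK g K by (auto simp: normal_iff_conjug)
  then have "p_subgroup p (G\<lparr>carrier := K\<rparr>) (conjug G g ` U)"
    using p_subgroup_conjug_image[OF Up g] p_subgroup_restrict_iff[OF Ks] by simp
  from K.sylow_conjug[OF p this U]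
  obtain k where k: "k \<in> K" "conjug (G\<lparr>carrier := K\<rparr>) k ` conjug G g ` U \<subseteq> U"
    by auto
  have kG: "k \<in> carrier G" using k Ks subgroup.mem_carrier by metis
  have "conjug G (g \<otimes> k) ` U \<subseteq> U"
    using k g kG UG Ks by (simp add: conjug_image_mult conjug_restrict)
  then have "conjug G (g \<otimes> k) ` U = U"
    using card_conjug_image[of "g \<otimes> k" U] g kG UG finite_subgroup[OF Us]
    by (simp add: card_subset_eq)
  then have n: "g \<otimes> k \<in> set_normalizer G U" using g kG by (simp add: set_normalizer_def)
  \<comment> \<open>In g = (g k) k^-1 the factor from \<open>K\<close> is moved to the left, where
    it becomes a conjugate and so remains in \<open>K\<close>.\<close>
  have "conjug G (inv (g \<otimes> k)) (inv k) \<in> K"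
    using K g kG k Ks by (auto simp: normal_iff_conjug subgroup.m_inv_closed)
  moreover have "g = conjug G (inv (g \<otimes> k)) (inv k) \<otimes> (g \<otimes> k)"
    using g kG by (simp add: conjug_def m_assoc inv_mult_group flip: m_assoc[of g "inv g"])
      (simp flip: m_assoc)
  ultimately show ?thesis using n by blast
qed

text \<open>The factor in \<open>K\<close> that the Frattini argument yields splits as c u with u in
  \<open>V \<inter> K\<close>. Since u normalizes \<open>V \<inter> K\<close>, the other factor
  absorbs it.\<close>

lemma frattini_centralizer:
  assumes p: "Factorial_Ring.prime p" and K: "K \<lhd> G" and V: "sylow_subgroup p G V"
    and P: "P \<subseteq> carrier G" and KC: "K \<subseteq> set_centralizer G P <#> (V \<inter> K)" and g: "g \<in> carrier G"
  shows "\<exists>c\<in>set_centralizer G P. \<exists>n\<in>set_normalizer G (V \<inter> K). g = c \<otimes> n"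
proof -
  have VK: "subgroup (V \<inter> K) G"
    using K V normal_imp_subgroup subgroups_Inter_pair by (auto simp: sylow_subgroup_def)
  obtain k n where kn: "k \<in> K" "n \<in> set_normalizer G (V \<inter> K)" "g = k \<otimes> n"
    using frattini_argument[OF p K sylow_inter_normal[OF p K V] g] by blast
  then obtain c u where cu: "c \<in> set_centralizer G P" "u \<in> V \<inter> K" "k = c \<otimes> u"
    using KC by (auto simp: set_mult_def)
  have N: "subgroup (set_normalizer G (V \<inter> K)) G"
    using VK subgroup.subset subgroup_set_normalizer by blast
  have "u \<in> set_normalizer G (V \<inter> K)" using cu(2) subgroup_subset_set_normalizer[OF VK] by blast
  then have "u \<otimes> n \<in> set_normalizer G (V \<inter> K)" using kn(2) N by (simp add: subgroup.m_closed)
  moreover have "c \<in> carrier G" "u \<in> carrier G" "n \<in> carrier G"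
    using cu kn(2) subgroup.mem_carrier[OF VK] by (auto simp: set_centralizer_def set_normalizer_def)
  then have "g = c \<otimes> (u \<otimes> n)" using kn(3) cu(3) by (simp add: m_assoc)
  ultimately show ?thesis using cu(1) by blast
qed

section \<open>Subgroups of prescribed order between two p-subgroups\<close>

lemma normalizer_grows_in_p_subgroup:
  assumes p: "Factorial_Ring.prime p" and S: "p_subgroup p G S" and P: "subgroup P G" "P \<subset> S"
  shows "P \<subset> S \<inter> set_normalizer G P"
proof -
  have Ss: "subgroup S G" using S by (simp add: p_subgroup_def)
  interpret S: finite_group "G\<lparr>carrier := S\<rparr>" using Ss by (rule finite_group_restrict)
  obtain n where "order (G\<lparr>carrier := S\<rparr>) = p ^ n"
    using S by (auto simp: p_subgroup_def order_def)
  then have "P \<subset> set_normalizer (G\<lparr>carrier := S\<rparr>) P"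
    by (rule S.p_group_normalizer_grows[OF p]) (use P Ss in \<open>auto simp: subgroup_restrict_iff\<close>)
  then show ?thesis by (simp add: set_normalizer_restrict[OF Ss])
qed

text \<open>\<open>P\<close> is normal in its normalizer in \<open>S\<close>, and its index there is
  a power of \<open>p\<close> other than 1 because normalizers grow. Cauchy's theorem in the
  quotient then applies.\<close>

lemma p_subgroup_step:
  assumes p: "Factorial_Ring.prime p" and S: "p_subgroup p G S" and P: "subgroup P G" "P \<subset> S"
  shows "\<exists>U. subgroup U G \<and> P \<subseteq> U \<and> U \<subseteq> S \<and> card U = p * card P"
proof -
  have Ss: "subgroup S G" using S by (simp add: p_subgroup_def)
  define N where "N = S \<inter> set_normalizer G P"
  have N: "subgroup N G"
    unfolding N_def
    by (intro subgroups_Inter_pair Ss subgroup_set_normalizer subgroup.subset[OF P(1)])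
  have PN: "P \<subset> N" unfolding N_def by (rule normalizer_grows_in_p_subgroup[OF p S P])
  interpret N: finite_group "G\<lparr>carrier := N\<rparr>" using N by (rule finite_group_restrict)
  have "P \<lhd> G\<lparr>carrier := N\<rparr>"
  proof -
    have "subgroup P (G\<lparr>carrier := N\<rparr>)" using P(1) N PN by (intro subgroup_incl) auto
    moreover have "N \<inter> set_normalizer G P = N" by (auto simp: N_def)
    ultimately show ?thesis
      using N by (simp add: N.normal_set_normalizer_iff set_normalizer_restrict)
  qed
  moreover have "p dvd card (rcosets\<^bsub>G\<lparr>carrier := N\<rparr>\<^esub> P)"
  proof -
    have idx: "card (rcosets\<^bsub>G\<lparr>carrier := N\<rparr>\<^esub> P) * card P = card N"
      using P N PN by (intro card_rcosets_restrict) auto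
    have "p_subgroup p G N" using p_subgroup_subset[OF p S N] by (simp add: N_def)
    then obtain k where k: "card (rcosets\<^bsub>G\<lparr>carrier := N\<rparr>\<^esub> P) = p ^ k"
      using idx divides_primepow_nat[OF p] by (auto simp: p_subgroup_def) (metis dvd_triv_left)
    have "card P \<noteq> card N"
      using PN psubset_card_mono[OF finite_subgroup[OF N] PN] by simp
    then have "k \<noteq> 0" using idx k by (metis mult_1 power_0)
    then show ?thesis using k by simp
  qed
  ultimately obtain U where "subgroup U (G\<lparr>carrier := N\<rparr>)" "P \<subseteq> U" "card U = p * card P"
    using N.subgroup_of_prime_index_over_normal[OF N.fin _ p] by blast
  moreover have "N \<subseteq> S" by (auto simp: N_def)
  ultimately show ?thesis using incl_subgroup[OF N] subgroup.subset by fastforce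
qed

lemma p_subgroup_intermediate:
  assumes p: "Factorial_Ring.prime p" and S: "subgroup S G" "card S = p ^ n"
    and P: "subgroup P G" "P \<subseteq> S" "card P = p ^ a" and n: "a + j \<le> n"
  shows "\<exists>U. subgroup U G \<and> P \<subseteq> U \<and> U \<subseteq> S \<and> card U = p ^ (a + j)"
  using n
proof (induction j)
  case 0
  show ?case by (rule exI[of _ P]) (simp add: P)
next
  case (Suc j)
  then obtain U where U: "subgroup U G" "P \<subseteq> U" "U \<subseteq> S" "card U = p ^ (a + j)" by auto
  have "p ^ (a + j) < p ^ n"
    using Suc.prems prime_gt_1_nat[OF p] by (intro power_strict_increasing) auto
  then have US: "U \<subset> S" using U S by auto
  have "p_subgroup p G S" using S by (auto simp: p_subgroup_def)
  then obtain W where "subgroup W G" "U \<subseteq> W" "W \<subseteq> S" "card W = p * card U"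
    using p_subgroup_step[OF p _ U(1) US] by blast
  then show ?case using U by (intro exI[of _ W]) auto
qed

end

section \<open>Chief factors of prime order and the supersolvable hypercenter\<close>

text \<open>\<open>Greatest\<close> is a definite description and is informative only once a
  greatest element is known to exist. In a finite directed family a maximal element is greatest;
  \<open>p_core\<close> and \<open>supersolvable_hypercenter\<close> are handled this way.\<close>

lemma Greatest_of_directed:
  fixes Q :: "'a::order \<Rightarrow> bool"
  assumes "finite {x. Q x}" "Q x0"
    and dir: "\<And>x y. Q x \<Longrightarrow> Q y \<Longrightarrow> \<exists>z. Q z \<and> x \<le> z \<and> y \<le> z"
  shows "Q (Greatest Q)" "Q x \<Longrightarrow> x \<le> Greatest Q"
proof -
  obtain m where m: "Q m" "\<And>y. Q y \<Longrightarrow> m \<le> y \<Longrightarrow> m = y"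
    using finite_has_maximal[OF assms(1)] assms(2) by auto
  have "y \<le> m" if "Q y" for y using dir[OF m(1) that] m(2) by metis
  then have "Greatest Q = m" using m(1) by (intro Greatest_equality)
  then show "Q (Greatest Q)" "Q x \<Longrightarrow> x \<le> Greatest Q"
    using m \<open>\<And>y. Q y \<Longrightarrow> y \<le> m\<close> by auto
qed

context group
begin

lemma set_mult_absorb:
  assumes "subgroup K G" "A \<subseteq> K" "\<one> \<in> A"
  shows "K <#> A = K"
proof
  show "K <#> A \<subseteq> K"
    using assms subgroup.m_closed[OF assms(1)] by (auto simp: set_mult_def)
  show "K \<subseteq> K <#> A"
    using assms subgroup.mem_carrier[OF assms(1)] by (force simp: set_mult_def)
qed

lemma set_mult_subset_subgroup:
  assumes "subgroup L G" "A \<subseteq> L" "B \<subseteq> L"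
  shows "A <#> B \<subseteq> L"
  using assms subgroup.m_closed[OF assms(1)] by (auto simp: set_mult_def)

text \<open>The modular law: if l = k a lies in \<open>L\<close>, then so does a = k^-1 l.\<close>

lemma dedekind:
  assumes "subgroup L G" "subgroup K G" "A \<subseteq> carrier G" "K \<subseteq> L" "L \<subseteq> K <#> A"
  shows "L = K <#> (L \<inter> A)"
proof
  show "K <#> (L \<inter> A) \<subseteq> L" using assms by (intro set_mult_subset_subgroup) auto
  show "L \<subseteq> K <#> (L \<inter> A)"
  proof
    fix l assume l: "l \<in> L"
    then obtain k a where ka: "k \<in> K" "a \<in> A" "l = k \<otimes> a" using assms(5) by (auto simp: set_mult_def)
    have "a = inv k \<otimes> l"
      using ka assms(3) subgroup.mem_carrier[OF assms(2)] by (auto simp flip: m_assoc)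
    moreover have "inv k \<otimes> l \<in> L"
      using ka(1) l assms(1,4) by (meson subgroup.m_closed subgroup.m_inv_closed subsetD)
    ultimately have "a \<in> L" by simp
    then show "l \<in> K <#> (L \<inter> A)" using ka by (auto simp: set_mult_def)
  qed
qed

lemma conjug_pow:
  "g \<in> carrier G \<Longrightarrow> x \<in> carrier G \<Longrightarrow> conjug G g (x [^] (n::nat)) = conjug G g x [^] n"
  by (induction n) (simp_all add: conjug_hom)

end

context finite_group
begin

text \<open>The second isomorphism theorem for chief factors, argued on normal subgroups:
  \<open>N\<close> between \<open>K \<inter> A\<close> and \<open>A\<close> corresponds to KN
  between \<open>K\<close> and KA.\<close>

lemma chief_factor_inter:
  assumes A: "A \<lhd> G" and K: "K \<lhd> G" and c: "chief_factor G (K <#> A) K"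
  shows "chief_factor G A (K \<inter> A)"
proof -
  have As: "subgroup A G" and Ks: "subgroup K G" using A K normal_imp_subgroup by auto
  have sub: "K <#> A \<lhd> G" "K \<subseteq> K <#> A" "A \<subseteq> K <#> A"
    using A K normal_set_mult subgroup_normal_mult[OF K As] by auto
  have cf: "N = K \<or> N = K <#> A" if "N \<lhd> G" "K \<subseteq> N" "N \<subseteq> K <#> A" for N
    using c that by (auto simp: chief_factor_def)
  have "K \<noteq> K <#> A" using c by (auto simp: chief_factor_def)
  then have "\<not> A \<subseteq> K" using set_mult_absorb[OF Ks] subgroup.one_closed[OF As] by metis
  moreover have "N = K \<inter> A \<or> N = A" if N: "N \<lhd> G" "K \<inter> A \<subseteq> N" "N \<subseteq> A" for N
  proof -
    have Ns: "subgroup N G" using N normal_imp_subgroup by auto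
    note subN = subgroup_normal_mult[OF K Ns]
    have "K <#> N \<subseteq> K <#> A" using N(3) by (intro mono_set_mult) auto
    then consider "K <#> N = K" | "K <#> N = K <#> A"
      using cf[of "K <#> N"] normal_set_mult[OF K N(1)] subN by blast
    then show ?thesis
    proof cases
      case 1
      then show ?thesis using subN N by blast
    next
      case 2
      \<comment> \<open>Writing a = k n puts k into \<open>K \<inter> A\<close>, which is contained
        in \<open>N\<close>.\<close>
      have "a \<in> N" if a: "a \<in> A" for a
      proof -
        have "a \<in> K <#> N" using a sub 2 by blast
        then obtain k n where kn: "k \<in> K" "n \<in> N" "a = k \<otimes> n" by (auto simp: set_mult_def)
        then have "k = a \<otimes> inv n"
          using subgroup.mem_carrier[OF Ks] subgroup.mem_carrier[OF Ns] by (simp add: m_assoc)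
        then have "k \<in> A"
          using a kn(2) N(3) As by (metis subgroup.m_closed subgroup.m_inv_closed subsetD)
        then show ?thesis using kn N(2) Ns by (metis IntI subgroup.m_closed subsetD)
      qed
      then show ?thesis using N by blast
    qed
  qed
  moreover have "K \<inter> A \<lhd> G" using A K by (rule_tac normal_subgroup_intersect)
  ultimately show ?thesis using A unfolding chief_factor_def by blast
qed

text \<open>By the modular law a normal subgroup \<open>L\<close> between \<open>K\<close> and KA is
  K(L \<inter> A), and there are only two candidates for \<open>L \<inter> A\<close>.\<close>

lemma chief_factor_mult:
  assumes A: "A \<lhd> G" and K: "K \<lhd> G" and c: "chief_factor G A (K \<inter> A)"
  shows "chief_factor G (K <#> A) K"
proof -
  have As: "subgroup A G" and Ks: "subgroup K G" using A K normal_imp_subgroup by auto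
  have sub: "K <#> A \<lhd> G" "K \<subseteq> K <#> A" "A \<subseteq> K <#> A"
    using A K normal_set_mult subgroup_normal_mult[OF K As] by auto
  have cf: "N = K \<inter> A \<or> N = A" if "N \<lhd> G" "K \<inter> A \<subseteq> N" "N \<subseteq> A" for N
    using c that by (auto simp: chief_factor_def)
  have "K \<noteq> K <#> A" using c sub by (auto simp: chief_factor_def)
  moreover have "L = K \<or> L = K <#> A" if L: "L \<lhd> G" "K \<subseteq> L" "L \<subseteq> K <#> A" for L
  proof -
    have "L = K <#> (L \<inter> A)"
      using L Ks normal_imp_subgroup subgroup.subset[OF As] by (intro dedekind) auto
    moreover have "L \<inter> A = K \<inter> A \<or> L \<inter> A = A"
      using cf[of "L \<inter> A"] normal_subgroup_intersect[OF L(1) A] L(2) by blast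
    moreover have "K <#> (K \<inter> A) = K"
      using Ks As by (intro set_mult_absorb) (auto intro: subgroup.one_closed)
    ultimately show ?thesis by metis
  qed
  ultimately show ?thesis using sub K unfolding chief_factor_def by blast
qed

lemma normal_subgroups_finite: "finite {N. N \<lhd> G \<and> Q N}"
proof (rule finite_subset)
  show "{N. N \<lhd> G \<and> Q N} \<subseteq> Pow (carrier G)"
    using normal_imp_subgroup subgroup.subset by fastforce
qed (simp add: fin)

text \<open>This lets later arguments count orders instead of handling quotient groups. A group of
  prime order is cyclic; conversely, in a cyclic chief factor the elements killed by a prime divisor
  of its order form a nontrivial invariant subgroup, hence everything.\<close>

lemma chief_factor_prime_index_iff_cyclic:
  assumes c: "chief_factor G H K"
  shows "cyclic_group ((G\<lparr>carrier := H\<rparr>) Mod K) \<longleftrightarrow>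
    (\<exists>q. Factorial_Ring.prime q \<and> card H = q * card K)"
proof -
  have HK: "H \<lhd> G" "K \<lhd> G" "K \<subset> H" using c by (auto simp: chief_factor_def)
  have Hs: "subgroup H G" and Ks: "subgroup K G" using HK normal_imp_subgroup by auto
  define B where "B = G\<lparr>carrier := H\<rparr>"
  define Q where "Q = B Mod K"
  interpret B: finite_group B unfolding B_def using Hs by (rule finite_group_restrict)
  have KB: "K \<lhd> B" unfolding B_def using HK Hs by (intro normal_restrict_supergroup) auto
  interpret KB: normal K B by (rule KB)
  interpret Q: group Q unfolding Q_def by (rule KB.factorgroup_is_group)
  have carrQ: "carrier Q = rcosets\<^bsub>B\<^esub> K" by (simp add: Q_def FactGroup_def)
  have ord: "order Q * card K = card H"
    using card_rcosets_restrict[OF Ks Hs] HK(3) by (simp add: order_def carrQ B_def)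
  have K0: "0 < card K" using Ks by (rule card_subgroup_pos)
  have finQ: "finite (carrier Q)" using B.fin by (simp add: carrQ RCOSETS_def)
  have "card K < card H" using HK(3) finite_subgroup[OF Hs] psubset_card_mono by blast
  then have ordQ1: "order Q \<noteq> 1" using ord by auto
  show ?thesis unfolding B_def[symmetric] Q_def[symmetric]
  proof
    assume "\<exists>q. Factorial_Ring.prime q \<and> card H = q * card K"
    then have prime: "Factorial_Ring.prime (order Q)" using ord K0 by auto
    then have "carrier Q \<noteq> {\<one>\<^bsub>Q\<^esub>}" by (auto simp: order_def)
    then obtain x where x: "x \<in> carrier Q" "x \<noteq> \<one>\<^bsub>Q\<^esub>" using Q.one_closed by blast
    then have "Q.ord x \<noteq> 1" using Q.ord_eq_1 by blast
    then have "Q.ord x = order Q"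
      using prime Q.ord_dvd_group_order[OF x(1)] by (metis prime_nat_iff)
    then have "card (generate Q {x}) = card (carrier Q)"
      using Q.generate_pow_card[OF x(1)] by (simp add: order_def)
    moreover have "generate Q {x} \<subseteq> carrier Q" using x Q.generate_incl by simp
    ultimately have "generate Q {x} = carrier Q" using finQ by (simp add: card_subset_eq)
    then have "subgroup_generated Q {x} = Q"
      using x by (simp add: subgroup_generated_def)
    then show "cyclic_group Q" using x(1) by (auto simp: cyclic_group_def)
  next
    assume cyc: "cyclic_group Q"
    then interpret Q: comm_group Q by (rule Q.cyclic_imp_abelian_group)
    obtain q where q: "Factorial_Ring.prime q" "q dvd order Q"
      using ordQ1 prime_factor_nat by blast
    \<comment> \<open>\<open>L\<close> is the preimage of the elements of H/K killed by
      \<open>q\<close>. It is a subgroup since H/K is abelian, and it is normal in \<open>G\<close>,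
      so it is \<open>K\<close> or \<open>H\<close>; Cauchy's theorem excludes
      \<open>K\<close>.\<close>
    define L where "L = {y \<in> H. y [^] q \<in> K}"
    have powH: "y [^] n \<in> H" if "y \<in> H" for y and n :: nat
      using that B.nat_pow_closed[of y n] nat_pow_consistent[of y n H] by (simp add: B_def)
    have powK: "(K #>\<^bsub>B\<^esub> y) [^]\<^bsub>Q\<^esub> n = K #>\<^bsub>B\<^esub> (y [^] n)" if "y \<in> H" for y and n :: nat
      using KB.FactGroup_pow[of y n] that nat_pow_consistent[of y n H] by (simp add: Q_def B_def)
    have inQ: "K #>\<^bsub>B\<^esub> y \<in> carrier Q" if "y \<in> H" for y
      using that by (auto simp: carrQ RCOSETS_def B_def)
    have inK: "K #>\<^bsub>B\<^esub> y = K \<longleftrightarrow> y \<in> K" if "y \<in> H" for y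
    proof
      have y: "y \<in> carrier B" using that by (simp add: B_def)
      show "y \<in> K" if "K #>\<^bsub>B\<^esub> y = K"
        using B.rcos_self[OF y KB.subgroup_axioms] that by simp
      show "K #>\<^bsub>B\<^esub> y = K" if "y \<in> K" by (rule KB.rcos_const[OF B.is_group that])
    qed
    have one: "\<one>\<^bsub>Q\<^esub> = K" by (simp add: Q_def)
    have L_iff: "y \<in> L \<longleftrightarrow> (K #>\<^bsub>B\<^esub> y) [^]\<^bsub>Q\<^esub> q = \<one>\<^bsub>Q\<^esub>" if "y \<in> H" for y
      using that powK[of y q] inK[of "y [^] q"] powH[of y q] by (simp add: L_def one)
    have LH: "L \<subseteq> H" by (auto simp: L_def)
    have HG: "\<And>y. y \<in> H \<Longrightarrow> y \<in> carrier G" using subgroup.mem_carrier[OF Hs] .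
    have "subgroup L G"
    proof (rule subgroupI)
      show "L \<subseteq> carrier G" using LH HG by blast
      have "\<one> \<in> L"
        using subgroup.one_closed[OF Hs] subgroup.one_closed[OF Ks] by (simp add: L_def)
      then show "L \<noteq> {}" by blast
      show "inv y \<in> L" if "y \<in> L" for y
        using that HG Hs Ks by (auto simp: L_def nat_pow_inv subgroup.m_inv_closed)
      show "y \<otimes> z \<in> L" if y: "y \<in> L" and z: "z \<in> L" for y z
      proof -
        have H: "y \<in> H" "z \<in> H" "y \<otimes> z \<in> H" using y z LH Hs by (auto intro: subgroup.m_closed)
        have "K #>\<^bsub>B\<^esub> (y \<otimes> z) = (K #>\<^bsub>B\<^esub> y) \<otimes>\<^bsub>Q\<^esub> (K #>\<^bsub>B\<^esub> z)"
          using KB.rcos_sum[of y z] H by (simp add: Q_def B_def)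
        then show ?thesis
          using y z H L_iff inQ by (simp add: Q.nat_pow_distrib)
      qed
    qed
    moreover have "conjug G g y \<in> L" if "g \<in> carrier G" "y \<in> L" for g y
      using that HK(1,2) LH HG by (auto simp: L_def normal_iff_conjug simp flip: conjug_pow)
    ultimately have "L \<lhd> G" by (simp add: normal_iff_conjug)
    moreover have "K \<subseteq> L"
      using HK(3) monoid.nat_pow_closed[OF group.is_monoid[OF subgroup_imp_group[OF Ks]]]
      by (auto simp: L_def nat_pow_consistent[of _ _ K])
    moreover have "L \<noteq> K"
    proof -
      obtain m where "order Q = q ^ 1 * m" using q(2) by auto
      then obtain A where A: "subgroup A Q" "card A = q"
        using sylow_thm[OF q(1) Q.is_group _ finQ] by fastforce
      have "A \<noteq> {\<one>\<^bsub>Q\<^esub>}" using A(2) q(1) by (auto simp: prime_nat_iff)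
      then obtain a where a: "a \<in> A" "a \<noteq> \<one>\<^bsub>Q\<^esub>" using subgroup.one_closed[OF A(1)] by blast
      have "a [^]\<^bsub>Q\<^esub> q = \<one>\<^bsub>Q\<^esub>"
        using group.pow_order_eq_1[OF Q.subgroup_imp_group[OF A(1)], of a] a(1) A(2)
        by (simp add: order_def Q.nat_pow_consistent[of a _ A])
      moreover obtain y where y: "y \<in> H" "a = K #>\<^bsub>B\<^esub> y"
        using a(1) subgroup.mem_carrier[OF A(1)] by (auto simp: carrQ RCOSETS_def B_def)
      ultimately have "y \<in> L" "y \<notin> K" using L_iff a(2) inK by (auto simp: one)
      then show ?thesis by blast
    qed
    ultimately have "L = H" using c LH by (auto simp: chief_factor_def)
    obtain x where x: "x \<in> carrier Q" "subgroup_generated Q {x} = Q"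
      using cyc by (auto simp: cyclic_group_def)
    obtain y where y: "y \<in> H" "x = K #>\<^bsub>B\<^esub> y"
      using x(1) by (auto simp: carrQ RCOSETS_def B_def)
    \<comment> \<open>As \<open>L = H\<close>, even the generator \<open>x\<close> is killed by
      \<open>q\<close>, so the order of the factor divides \<open>q\<close>.\<close>
    then have "x [^]\<^bsub>Q\<^esub> q = \<one>\<^bsub>Q\<^esub>" using L_iff \<open>L = H\<close> by simp
    then have "order Q dvd q"
      using Q.pow_eq_id[OF x(1)] Q.cyclic_order_is_ord[OF x(1)] x(2) by simp
    then have "order Q = q" using ordQ1 q(1) by (auto simp: prime_nat_iff)
    then show "\<exists>q. Factorial_Ring.prime q \<and> card H = q * card K" using q(1) ord by metis
  qed
qed

text \<open>The numerical side of the second isomorphism theorem; it carries a prime index from one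
  chief factor to an isomorphic one.\<close>

lemma card_normal_mult_index:
  assumes "A \<lhd> G" "K \<lhd> G"
  shows "card (K <#> A) = q * card K \<longleftrightarrow> card A = q * card (K \<inter> A)"
proof -
  have s: "subgroup A G" "subgroup K G" "subgroup (K \<inter> A) G"
    using assms normal_imp_subgroup subgroups_Inter_pair by metis+
  have "card (K <#> A) * card (K \<inter> A) = card K * card A" using assms(2) s(1) by (rule card_normal_mult)
  moreover have "0 < card K" "0 < card (K \<inter> A)" using s card_subgroup_pos by auto
  ultimately show ?thesis by (auto simp: mult.assoc)
qed

text \<open>The condition under \<open>GREATEST\<close> in \<open>supersolvable_hypercenter\<close>,
  with cyclic factors replaced by prime indices; the two agree by
  \<open>chief_factor_prime_index_iff_cyclic\<close>.\<close>

definition prime_chief_below :: "'a set \<Rightarrow> bool"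
  where "prime_chief_below N \<longleftrightarrow> N \<lhd> G \<and> (\<forall>H K. chief_factor G H K \<and> H \<subseteq> N \<longrightarrow>
    (\<exists>q. Factorial_Ring.prime q \<and> card H = q * card K))"

text \<open>This makes the family whose greatest member defines the hypercenter directed; otherwise \<open>Greatest\<close>
  would return an unspecified set.\<close>

lemma prime_chief_below_set_mult:
  assumes M: "prime_chief_below M" and N: "prime_chief_below N"
  shows "prime_chief_below (M <#> N)"
  unfolding prime_chief_below_def
proof (intro conjI allI impI)
  have Mn: "M \<lhd> G" and Nn: "N \<lhd> G" using M N by (auto simp: prime_chief_below_def)
  then have Ms: "subgroup M G" and Ns: "subgroup N G" using normal_imp_subgroup by auto
  show MN: "M <#> N \<lhd> G" using Mn Nn by (rule normal_set_mult)
  then have MNs: "subgroup (M <#> N) G" by (rule normal_imp_subgroup)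
  fix H K assume c: "chief_factor G H K \<and> H \<subseteq> M <#> N"
  then have HK: "H \<lhd> G" "K \<lhd> G" "K \<subset> H" by (auto simp: chief_factor_def)
  have Hs: "subgroup H G" and Ks: "subgroup K G" using HK normal_imp_subgroup by auto
  have HM: "H \<inter> M \<lhd> G" using HK(1) Mn by (rule normal_subgroup_intersect)
  show "\<exists>q. Factorial_Ring.prime q \<and> card H = q * card K"
  proof (cases "H \<inter> M \<subseteq> K")
    \<comment> \<open>Here H = K(H \<inter> M), so H/K is isomorphic to a chief factor below
      \<open>M\<close>.\<close>
    case False
    note sub = subgroup_normal_mult[OF HK(2) normal_imp_subgroup[OF HM]]
    have "K <#> (H \<inter> M) \<subseteq> H" using HK(3) by (intro set_mult_subset_subgroup Hs) auto
    moreover have "K <#> (H \<inter> M) \<noteq> K" using False sub(3) by blast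
    ultimately have eq: "K <#> (H \<inter> M) = H"
      using c normal_set_mult[OF HK(2) HM] sub(2) by (auto simp: chief_factor_def)
    then have "chief_factor G (H \<inter> M) (K \<inter> (H \<inter> M))"
      using c by (intro chief_factor_inter[OF HM HK(2)]) simp
    then obtain q where q: "Factorial_Ring.prime q" "card (H \<inter> M) = q * card (K \<inter> (H \<inter> M))"
      using M by (auto simp: prime_chief_below_def)
    then have "card H = q * card K" using card_normal_mult_index[OF HM HK(2)] eq by simp
    then show ?thesis using q(1) by blast
  next
    case True
    \<comment> \<open>Now the factor is shifted upwards by \<open>M\<close>. As K' \<inter> H = K,
      the factor H'/K' is isomorphic to H/K; as K' contains \<open>M\<close> and H' lies in MN, H' =
      K'(H' \<inter> N), so H'/K' is isomorphic to a chief factor below \<open>N\<close>.\<close>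
    define K' where "K' = K <#> M"
    define H' where "H' = K' <#> H"
    have K': "K' \<lhd> G" unfolding K'_def using HK(2) Mn by (rule normal_set_mult)
    have H': "H' \<lhd> G" unfolding H'_def using K' HK(1) by (rule normal_set_mult)
    have K's: "subgroup K' G" and H's: "subgroup H' G" using K' H' normal_imp_subgroup by auto
    note subK = subgroup_normal_mult[OF HK(2) Ms, folded K'_def]
    note subH = subgroup_normal_mult[OF K' Hs, folded H'_def]
    note subMN = subgroup_normal_mult[OF Mn Ns]
    have "K' \<inter> H = K <#> (K' \<inter> H \<inter> M)"
      using K's Hs Ks HK(3) subK subgroup.subset[OF Ms]
      by (intro dedekind subgroups_Inter_pair) (auto simp: K'_def)
    also have "\<dots> = K"
      using True K's Hs Ms subgroup.one_closed by (intro set_mult_absorb Ks) auto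
    finally have K'H: "K' \<inter> H = K" .
    have c': "chief_factor G H' K'"
      unfolding H'_def using c by (intro chief_factor_mult HK(1) K') (simp add: K'H)
    have "K' \<subseteq> M <#> N"
      unfolding K'_def using c HK(3) subMN by (intro set_mult_subset_subgroup MNs) auto
    then have H'MN: "H' \<subseteq> M <#> N"
      unfolding H'_def using c by (intro set_mult_subset_subgroup MNs) auto
    have H'N: "H' \<inter> N \<lhd> G" using H' Nn by (rule normal_subgroup_intersect)
    have "H' = M <#> (H' \<inter> N)"
      using H's Ms H'MN subK subH subgroup.subset[OF Ns] by (intro dedekind) auto
    also have "\<dots> \<subseteq> K' <#> (H' \<inter> N)" using subK by (intro mono_set_mult) auto
    finally have "H' \<subseteq> K' <#> (H' \<inter> N)" .
    moreover have "K' <#> (H' \<inter> N) \<subseteq> H'" using subH by (intro set_mult_subset_subgroup H's) auto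
    ultimately have eq: "K' <#> (H' \<inter> N) = H'" by blast
    then have "chief_factor G (H' \<inter> N) (K' \<inter> (H' \<inter> N))"
      using c' by (intro chief_factor_inter[OF H'N K']) simp
    then obtain q where q: "Factorial_Ring.prime q" "card (H' \<inter> N) = q * card (K' \<inter> (H' \<inter> N))"
      using N by (auto simp: prime_chief_below_def)
    then have "card H' = q * card K'" using card_normal_mult_index[OF H'N K'] eq by simp
    then have "card H = q * card K"
      using card_normal_mult_index[OF HK(1) K', folded H'_def] K'H by simp
    then show ?thesis using q(1) by blast
  qed
qed

text \<open>By directedness the hypercenter itself satisfies the defining condition, which then
  passes to every normal subgroup inside it.\<close>

lemma prime_chief_below_hypercenter:
  assumes P: "P \<lhd> G" "P \<subseteq> supersolvable_hypercenter G"
  shows "prime_chief_below P"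
proof -
  have eq: "supersolvable_hypercenter G = Greatest prime_chief_below"
    unfolding supersolvable_hypercenter_def prime_chief_below_def
    by (rule arg_cong[where f = Greatest]) (auto simp: fun_eq_iff chief_factor_prime_index_iff_cyclic)
  have "prime_chief_below (Greatest prime_chief_below)"
  proof (rule Greatest_of_directed(1))
    show "finite {N. prime_chief_below N}"
      unfolding prime_chief_below_def by (rule normal_subgroups_finite)
    \<comment> \<open>A chief factor below the trivial subgroup would have a bottom that misses the
      identity.\<close>
    show "prime_chief_below {\<one>}"
      using normal_imp_subgroup subgroup.one_closed
      by (fastforce simp: prime_chief_below_def chief_factor_def one_is_normal)
    show "\<exists>L. prime_chief_below L \<and> M \<subseteq> L \<and> N \<subseteq> L" if "prime_chief_below M" "prime_chief_below N" for M N
      using prime_chief_below_set_mult[OF that] subgroup_normal_mult[of M N] that normal_imp_subgroup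
      by (auto simp: prime_chief_below_def)
  qed
  then show ?thesis using P by (auto simp: prime_chief_below_def eq)
qed

lemma p_subgroup_set_mult:
  assumes p: "Factorial_Ring.prime p" and M: "M \<lhd> G" "p_subgroup p G M" and N: "p_subgroup p G N"
  shows "p_subgroup p G (M <#> N)"
proof -
  obtain m n where mn: "card M = p ^ m" "card N = p ^ n" "subgroup N G"
    using M N by (auto simp: p_subgroup_def)
  have "card (M <#> N) dvd p ^ (m + n)"
    using card_normal_mult[OF M(1) mn(3)] mn by (metis dvd_triv_left power_add)
  then show ?thesis
    using divides_primepow_nat[OF p] subgroup_normal_mult[OF M(1) mn(3)]
    by (auto simp: p_subgroup_def)
qed

text \<open>Products of normal p-subgroups are normal p-subgroups, so the family is directed and its
  greatest member exists.\<close>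

lemma p_core:
  assumes p: "Factorial_Ring.prime p"
  shows "p_core p G \<lhd> G" "p_subgroup p G (p_core p G)"
    and "N \<lhd> G \<Longrightarrow> p_subgroup p G N \<Longrightarrow> N \<subseteq> p_core p G"
proof -
  have fin: "finite {N. N \<lhd> G \<and> p_subgroup p G N}" by (rule normal_subgroups_finite)
  have one: "{\<one>} \<lhd> G \<and> p_subgroup p G {\<one>}"
    using one_is_normal triv_subgroup by (auto simp: p_subgroup_def intro: exI[of _ 0])
  have dir: "\<exists>L. (L \<lhd> G \<and> p_subgroup p G L) \<and> M \<subseteq> L \<and> N \<subseteq> L"
    if M: "M \<lhd> G \<and> p_subgroup p G M" and N: "N \<lhd> G \<and> p_subgroup p G N" for M N
    using that p_subgroup_set_mult[OF p] normal_set_mult[of M N]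
      subgroup_normal_mult[of M N] normal_imp_subgroup by blast
  note gr = Greatest_of_directed[where Q = "\<lambda>N. N \<lhd> G \<and> p_subgroup p G N", OF fin one dir]
  show "p_core p G \<lhd> G" "p_subgroup p G (p_core p G)" using gr(1) by (auto simp: p_core_def)
  show "N \<lhd> G \<Longrightarrow> p_subgroup p G N \<Longrightarrow> N \<subseteq> p_core p G"
    using gr(2)[of N] by (simp add: p_core_def)
qed

end

section \<open>The centralizer of the chief factors below a p-subgroup\<close>

text \<open>This is C_G(H/K), expressed through the commutators [x,g] = x^-1 x^g, so that no action
  on a quotient group has to be set up.\<close>

definition factor_centralizer :: "('a, 'b) monoid_scheme \<Rightarrow> 'a set \<Rightarrow> 'a set \<Rightarrow> 'a set"
  where "factor_centralizer G H K =
    {g \<in> carrier G. \<forall>x\<in>H. inv\<^bsub>G\<^esub> x \<otimes>\<^bsub>G\<^esub> conjug G g x \<in> K}"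

text \<open>All chief factors below \<open>P\<close> are used rather than those of one series, so
  that no choice enters and normality is immediate.\<close>

definition chief_centralizer :: "'a monoid \<Rightarrow> 'a set \<Rightarrow> 'a set"
  where "chief_centralizer G P = {g \<in> carrier G.
    \<forall>H K. chief_factor G H K \<and> H \<subseteq> P \<longrightarrow> g \<in> factor_centralizer G H K}"

context group
begin

lemma factor_centralizerD:
  assumes "g \<in> factor_centralizer G H K" "x \<in> H" "H \<subseteq> carrier G"
  shows "\<exists>k\<in>K. conjug G g x = x \<otimes> k"
proof
  have "x \<in> carrier G" "g \<in> carrier G" using assms by (auto simp: factor_centralizer_def)
  then show "conjug G g x = x \<otimes> (inv x \<otimes> conjug G g x)" by (simp flip: m_assoc)
  show "inv x \<otimes> conjug G g x \<in> K" using assms by (simp add: factor_centralizer_def)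
qed

lemma factor_centralizerI:
  assumes "g \<in> carrier G" "H \<subseteq> carrier G" "K \<subseteq> carrier G"
    and "\<And>x. x \<in> H \<Longrightarrow> \<exists>k\<in>K. conjug G g x = x \<otimes> k"
  shows "g \<in> factor_centralizer G H K"
proof -
  have "inv x \<otimes> conjug G g x \<in> K" if x: "x \<in> H" for x
  proof -
    obtain k where k: "k \<in> K" "conjug G g x = x \<otimes> k" using assms(4)[OF x] by blast
    moreover have "x \<in> carrier G" "k \<in> carrier G" using x k(1) assms(2,3) by auto
    then have "inv x \<otimes> (x \<otimes> k) = k" by (simp flip: m_assoc)
    ultimately show ?thesis by simp
  qed
  then show ?thesis using assms(1) by (simp add: factor_centralizer_def)
qed

text \<open>All closure properties use the form x^g = x k with k in \<open>K\<close>. For instance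
  x^(g h) = x l k^h, where l k^h lies in \<open>K\<close> because \<open>K\<close> is
  normal.\<close>

lemma normal_factor_centralizer:
  assumes H: "H \<lhd> G" and K: "K \<lhd> G"
  shows "factor_centralizer G H K \<lhd> G"
proof -
  have Hs: "subgroup H G" and Ks: "subgroup K G" using H K normal_imp_subgroup by auto
  have HG: "H \<subseteq> carrier G" and KG: "K \<subseteq> carrier G" using Hs Ks subgroup.subset by auto
  have car: "g \<in> carrier G" if "g \<in> factor_centralizer G H K" for g
    using that by (simp add: factor_centralizer_def)
  have conjH: "conjug G g x \<in> H" if "g \<in> carrier G" "x \<in> H" for g x
    using H that by (simp add: normal_iff_conjug)
  have conjK: "conjug G g x \<in> K" if "g \<in> carrier G" "x \<in> K" for g x
    using K that by (simp add: normal_iff_conjug)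
  note I = factor_centralizerI[OF _ HG KG] and D = factor_centralizerD[OF _ _ HG]
  show ?thesis unfolding normal_iff_conjug
  proof (intro conjI ballI subgroupI)
    show "factor_centralizer G H K \<subseteq> carrier G" using car by blast
    have "\<one> \<in> factor_centralizer G H K"
      using HG subgroup.one_closed[OF Ks] by (intro I bexI[of _ \<one>]) auto
    then show "factor_centralizer G H K \<noteq> {}" by blast
    show "inv g \<in> factor_centralizer G H K" if g: "g \<in> factor_centralizer G H K" for g
    proof (rule I)
      fix x assume x: "x \<in> H"
      have y: "conjug G (inv g) x \<in> H" using conjH x car[OF g] by simp
      obtain k where k: "k \<in> K" "conjug G g (conjug G (inv g) x) = conjug G (inv g) x \<otimes> k"
        using D[OF g y] by blast
      then have "conjug G (inv g) x = x \<otimes> inv k"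
        using x y HG KG car[OF g] by (simp add: subset_iff m_assoc inv_solve_right)
      then show "\<exists>k\<in>K. conjug G (inv g) x = x \<otimes> k"
        using subgroup.m_inv_closed[OF Ks k(1)] by blast
    qed (use car[OF g] in simp)
    show "g \<otimes> h \<in> factor_centralizer G H K"
      if g: "g \<in> factor_centralizer G H K" and h: "h \<in> factor_centralizer G H K" for g h
    proof (rule I)
      fix x assume x: "x \<in> H"
      obtain k where k: "k \<in> K" "conjug G g x = x \<otimes> k" using D[OF g x] by blast
      obtain l where l: "l \<in> K" "conjug G h x = x \<otimes> l" using D[OF h x] by blast
      have "conjug G (g \<otimes> h) x = x \<otimes> (l \<otimes> conjug G h k)"
        using k l x car[OF g] car[OF h] HG KG by (simp add: subset_iff conjug_mult conjug_hom m_assoc)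
      moreover have "l \<otimes> conjug G h k \<in> K"
        using l(1) conjK[OF car[OF h] k(1)] by (rule subgroup.m_closed[OF Ks])
      ultimately show "\<exists>k\<in>K. conjug G (g \<otimes> h) x = x \<otimes> k" by blast
    qed (use car[OF g] car[OF h] in simp)
    fix a g assume a: "a \<in> carrier G" and g: "g \<in> factor_centralizer G H K"
    show "conjug G a g \<in> factor_centralizer G H K"
    proof (rule I)
      fix x assume x: "x \<in> H"
      have y: "conjug G (inv a) x \<in> H" using conjH x a by simp
      obtain k where k: "k \<in> K" "conjug G g (conjug G (inv a) x) = conjug G (inv a) x \<otimes> k"
        using D[OF g y] by blast
      have "conjug G (conjug G a g) x = conjug G a (conjug G g (conjug G (inv a) x))"
        using a car[OF g] x HG by (simp add: conjug_def[of G a g] conjug_mult subset_iff)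
      also have "\<dots> = x \<otimes> conjug G a k"
        using k a x y HG KG by (simp add: subset_iff conjug_hom)
      finally show "\<exists>k\<in>K. conjug G (conjug G a g) x = x \<otimes> k"
        using conjK[OF a k(1)] by blast
    qed (use a car[OF g] in simp)
  qed
qed

lemma conjug_rcoset:
  assumes "K \<lhd> G" "g \<in> carrier G" "x \<in> carrier G"
  shows "conjug G g ` (K #> x) = K #> conjug G g x"
proof -
  have "K \<subseteq> carrier G" using assms(1) normal_imp_subgroup subgroup.subset by blast
  then have "conjug G g ` (K #> x) = (\<lambda>y. y \<otimes> conjug G g x) ` conjug G g ` K"
    using assms by (force simp: r_coset_def image_iff conjug_hom subset_iff)
  then show ?thesis
    using normal_conjug_image[OF assms(1,2)] by (auto simp: r_coset_def)
qed

end

context finite_group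
begin

text \<open>\<open>V\<close> acts by conjugation on the \<open>p\<close> cosets of \<open>K\<close>
  in \<open>H\<close> and fixes the coset \<open>K\<close>. The number of moved cosets is divisible
  by \<open>p\<close> and smaller than \<open>p\<close>, hence 0.\<close>

lemma p_subgroup_subset_factor_centralizer:
  assumes p: "Factorial_Ring.prime p" and V: "p_subgroup p G V"
    and H: "H \<lhd> G" and K: "K \<lhd> G" and KH: "K \<subseteq> H" and card: "card H = p * card K"
  shows "V \<subseteq> factor_centralizer G H K"
proof -
  have Hs: "subgroup H G" and Ks: "subgroup K G" using H K normal_imp_subgroup by auto
  obtain n where Vs: "subgroup V G" and n: "card V = p ^ n" using V by (auto simp: p_subgroup_def)
  have HG: "H \<subseteq> carrier G" and KG: "K \<subseteq> carrier G" and VG: "V \<subseteq> carrier G"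
    using Hs Ks Vs subgroup.subset by auto
  define E where "E = (\<lambda>x. K #> x) ` H"
  have finE: "finite E" unfolding E_def using finite_subgroup[OF Hs] by simp
  have "E = rcosets\<^bsub>G\<lparr>carrier := H\<rparr>\<^esub> K" by (auto simp: E_def RCOSETS_def)
  then have "card E * card K = card H" using card_rcosets_restrict[OF Ks Hs KH] by simp
  then have cardE: "card E = p" using card card_subgroup_pos[OF Ks] by simp
  have conjE: "conjug G g ` Y \<in> E" if "g \<in> carrier G" "Y \<in> E" for g Y
    using that H HG by (auto simp: E_def conjug_rcoset[OF K] subset_iff normal_iff_conjug)
  have EG: "Y \<subseteq> carrier G" if "Y \<in> E" for Y
    using that r_coset_subset_G[OF KG] HG by (auto simp: E_def)
  let ?\<phi> = "\<lambda>g. restrict (\<lambda>Y. conjug G (inv g) ` Y) E"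
  have "group_action (G\<lparr>carrier := V\<rparr>) E ?\<phi>"
  proof (rule group_actionI)
    show "group (G\<lparr>carrier := V\<rparr>)" using Vs by (rule subgroup_imp_group)
    show "conjug G (inv \<one>\<^bsub>G\<lparr>carrier := V\<rparr>\<^esub>) ` Y = Y" if "Y \<in> E" for Y
      using EG[OF that] by (simp add: subset_iff)
    show "conjug G (inv (g \<otimes>\<^bsub>G\<lparr>carrier := V\<rparr>\<^esub> h)) ` Y = conjug G (inv g) ` conjug G (inv h) ` Y"
      if "g \<in> carrier (G\<lparr>carrier := V\<rparr>)" "h \<in> carrier (G\<lparr>carrier := V\<rparr>)" "Y \<in> E" for g h Y
      using that VG EG by (simp add: subset_iff inv_mult_group conjug_image_mult)
  qed (use conjE VG in auto)
  then have "p dvd card {Y \<in> E. \<exists>g\<in>carrier (G\<lparr>carrier := V\<rparr>). ?\<phi> g Y \<noteq> Y}"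
    by (rule group_action.prime_dvd_card_moved_points[OF _ finE p]) (simp add: order_def n)
  moreover define M where "M = {Y \<in> E. \<exists>g\<in>carrier (G\<lparr>carrier := V\<rparr>). ?\<phi> g Y \<noteq> Y}"
  ultimately have "p dvd card M" by simp
  have ME: "M \<subseteq> E" by (auto simp: M_def)
  have "card M < p"
  proof -
    have "K = K #> \<one>" using KG by simp
    then have "K \<in> E" unfolding E_def using subgroup.one_closed[OF Hs] by blast
    moreover have "?\<phi> g K = K" if "g \<in> V" for g
      using normal_conjug_image[OF K, of "inv g"] that VG \<open>K \<in> E\<close> by (simp add: subset_iff)
    then have "K \<notin> M" by (simp add: M_def)
    ultimately have "M \<subset> E" using ME by blast
    then show ?thesis using psubset_card_mono[OF finE] cardE by metis
  qed
  then have "card M = 0" using \<open>p dvd card M\<close> dvd_imp_le[of p "card M"] by linarith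
  then have "M = {}" using finite_subset[OF ME finE] by simp
  then have fixed: "?\<phi> g Y = Y" if "Y \<in> E" "g \<in> V" for g Y
    using that unfolding M_def by auto
  show ?thesis
  proof
    fix v assume v: "v \<in> V"
    then have vG: "v \<in> carrier G" using VG by blast
    show "v \<in> factor_centralizer G H K"
    proof (rule factor_centralizerI[OF vG HG KG])
      fix x assume x: "x \<in> H"
      then have xG: "x \<in> carrier G" using HG by blast
      have KE: "K #> x \<in> E" unfolding E_def using x by (rule imageI)
      have "conjug G v ` (K #> x) = K #> x"
        using fixed[OF KE subgroup.m_inv_closed[OF Vs v]] KE vG by simp
      then have "K #> conjug G v x = K #> x" using conjug_rcoset[OF K vG xG] by simp
      then have "conjug G v x \<in> K #> x" using rcos_self[OF conjug_closed[OF vG xG] Ks] by simp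
      then obtain k where k: "k \<in> K" "conjug G v x = k \<otimes> x" by (auto simp: r_coset_def)
      then have "conjug G v x = x \<otimes> conjug G x k"
        using xG KG by (auto simp: conjug_def[of G x k] simp flip: m_assoc)
      moreover have "conjug G x k \<in> K" using K k(1) xG by (simp add: normal_iff_conjug)
      ultimately show "\<exists>k\<in>K. conjug G v x = x \<otimes> k" by blast
    qed
  qed
qed

section \<open>Chief series and the subgroup acting trivially on all chief factors below a
  p-subgroup\<close>

lemma chief_factor_exists:
  assumes "N \<lhd> G" "N \<noteq> {\<one>}"
  shows "\<exists>K. chief_factor G N K"
proof -
  have "\<one> \<in> N" using assms(1) normal_imp_subgroup subgroup.one_closed by blast
  then have "{\<one>} \<in> {K. K \<lhd> G \<and> K \<subset> N}" using assms(2) one_is_normal by blast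
  moreover have "finite {K. K \<lhd> G \<and> K \<subset> N}" by (rule normal_subgroups_finite)
  ultimately obtain K where "K \<in> {K. K \<lhd> G \<and> K \<subset> N}"
    "\<forall>L\<in>{K. K \<lhd> G \<and> K \<subset> N}. K \<subseteq> L \<longrightarrow> K = L"
    using finite_has_maximal[of "{K. K \<lhd> G \<and> K \<subset> N}"] by blast
  then have "chief_factor G N K" using assms(1) by (auto simp: chief_factor_def)
  then show ?thesis by blast
qed

lemma chief_factor_card_less:
  assumes "chief_factor G N K"
  shows "card K < card N"
proof -
  have "N \<lhd> G" "K \<subset> N" using assms by (auto simp: chief_factor_def)
  then show ?thesis
    using finite_subgroup[OF normal_imp_subgroup] psubset_card_mono by blast
qed

lemma chief_series_exists:
  assumes "N \<lhd> G"
  shows "\<exists>n T. T 0 = {\<one>} \<and> T n = N \<and> (\<forall>i\<le>n. T i \<lhd> G) \<and>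
    (\<forall>i<n. chief_factor G (T (Suc i)) (T i))"
  using assms
proof (induction "card N" arbitrary: N rule: less_induct)
  case less
  show ?case
  proof (cases "N = {\<one>}")
    case True
    then show ?thesis using one_is_normal by (intro exI[of _ 0] exI[of _ "\<lambda>_. {\<one>}"]) simp
  next
    case False
    then obtain K where K: "chief_factor G N K" using chief_factor_exists less.prems by blast
    then have "K \<lhd> G" by (simp add: chief_factor_def)
    then obtain n T where T: "T 0 = {\<one>}" "T n = K" "\<forall>i\<le>n. T i \<lhd> G"
      "\<forall>i<n. chief_factor G (T (Suc i)) (T i)"
      using less.hyps[OF chief_factor_card_less[OF K]] by blast
    show ?thesis
      by (rule exI[of _ "Suc n"], rule exI[of _ "T(Suc n := N)"])
        (use T K less.prems in \<open>auto simp: less_Suc_eq le_Suc_eq\<close>)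
  qed
qed

lemma normal_chief_centralizer: "chief_centralizer G P \<lhd> G"
proof -
  \<comment> \<open>Inserting \<open>carrier G\<close> keeps the family nonempty when no chief
    factor lies below \<open>P\<close>.\<close>
  let ?F = "insert (carrier G) {factor_centralizer G H K | H K. chief_factor G H K \<and> H \<subseteq> P}"
  have eq: "chief_centralizer G P = \<Inter>?F" by (auto simp: chief_centralizer_def)
  have n: "N \<lhd> G" if N: "N \<in> ?F" for N
  proof (cases "N = carrier G")
    case False
    then obtain H K where "N = factor_centralizer G H K" "chief_factor G H K" using N by blast
    then show ?thesis by (simp add: chief_factor_def normal_factor_centralizer)
  qed (simp add: normal_self)
  then have "\<And>N. N \<in> ?F \<Longrightarrow> subgroup N G" by (rule normal_imp_subgroup)
  then have sub: "subgroup (\<Inter>?F) G" by (intro subgroups_Inter) blast+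
  have conj: "conjug G g x \<in> \<Inter>?F" if "g \<in> carrier G" "x \<in> \<Inter>?F" for g x
  proof
    fix N assume N: "N \<in> ?F"
    then have "x \<in> N" using that(2) by (rule InterD[rotated])
    then show "conjug G g x \<in> N" using n[OF N] that(1) by (simp add: normal_iff_conjug)
  qed
  show ?thesis unfolding eq normal_iff_conjug by (intro conjI ballI sub conj)
qed

text \<open>Since \<open>P\<close> is a p-group, the prime order of every chief factor below it is
  \<open>p\<close>.\<close>

lemma p_subgroup_subset_chief_centralizer:
  assumes p: "Factorial_Ring.prime p" and V: "p_subgroup p G V"
    and P: "prime_chief_below P" "p_subgroup p G P"
  shows "V \<subseteq> chief_centralizer G P"
proof -
  have "V \<subseteq> factor_centralizer G H K" if c: "chief_factor G H K" "H \<subseteq> P" for H K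
  proof -
    have HK: "H \<lhd> G" "K \<lhd> G" "K \<subset> H" using c by (auto simp: chief_factor_def)
    obtain q where q: "Factorial_Ring.prime q" "card H = q * card K"
      using P(1) c unfolding prime_chief_below_def by blast
    have "p_subgroup p G H"
      using p_subgroup_subset[OF p P(2) normal_imp_subgroup[OF HK(1)] c(2)] .
    then obtain n where "card H = p ^ n" by (auto simp: p_subgroup_def)
    then have "q dvd p ^ n" using q(2) by (metis dvd_triv_left)
    then have "q = p" using q(1) p by (metis prime_dvd_power primes_dvd_imp_eq)
    then show ?thesis
      using p_subgroup_subset_factor_centralizer[OF p V HK(1,2)] HK(3) q(2) by blast
  qed
  moreover have "V \<subseteq> carrier G" using V subgroup.subset by (auto simp: p_subgroup_def)
  ultimately show ?thesis unfolding chief_centralizer_def by blast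
qed

text \<open>Coprime action. Let N/K be a chief factor; by induction \<open>a\<close> centralizes
  \<open>K\<close>, and it acts trivially on N/K, so x^a = x z with z in \<open>K\<close> fixed by
  \<open>a\<close>. Iterating \<open>m\<close> times gives z^m = 1, and as the order of z is also a
  power of \<open>p\<close>, z = 1.\<close>

lemma coprime_chief_centralizer:
  assumes p: "Factorial_Ring.prime p" and P: "p_subgroup p G P"
    and a: "a \<in> chief_centralizer G P" "a [^] (m::nat) = \<one>" "coprime m p"
    and N: "N \<lhd> G" "N \<subseteq> P"
  shows "a \<in> set_centralizer G N"
  using N
proof (induction "card N" arbitrary: N rule: less_induct)
  case less
  have aG: "a \<in> carrier G" using a(1) by (simp add: chief_centralizer_def)
  have NG: "N \<subseteq> carrier G" using less.prems normal_imp_subgroup subgroup.subset by blast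
  show ?case
  proof (cases "N = {\<one>}")
    case True
    then show ?thesis using aG by (simp add: set_centralizer_def)
  next
    case False
    then obtain K where K: "chief_factor G N K" using chief_factor_exists less.prems by blast
    then have KN: "K \<lhd> G" "K \<subset> N" by (auto simp: chief_factor_def)
    have aK: "a \<in> set_centralizer G K"
      using less.hyps[OF chief_factor_card_less[OF K] KN(1)] KN(2) less.prems by blast
    have "conjug G a x = x" if x: "x \<in> N" for x
    proof -
      have xG: "x \<in> carrier G" using x NG by blast
      have "a \<in> factor_centralizer G N K"
        using a(1) K less.prems by (simp add: chief_centralizer_def)
      then obtain z where z: "z \<in> K" "conjug G a x = x \<otimes> z"
        using factor_centralizerD[OF _ x NG] by blast
      have zN: "z \<in> N" and zG: "z \<in> carrier G" using z(1) KN(2) NG by auto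
      have az: "conjug G a z = z" using aK z(1) by (simp add: set_centralizer_def)
      have "conjug G (a [^] i) x = x \<otimes> z [^] i" for i :: nat
      proof (induction i)
        case (Suc i)
        have "conjug G (a [^] Suc i) x = conjug G a (x \<otimes> z [^] i)"
          using Suc aG xG by (simp add: conjug_mult)
        also have "\<dots> = x \<otimes> (z \<otimes> z [^] i)"
          using aG xG zG z(2) az by (simp add: conjug_hom conjug_pow m_assoc)
        also have "z \<otimes> z [^] i = z [^] Suc i" using zG by (rule nat_pow_Suc2[symmetric])
        finally show ?case .
      qed (use xG in simp)
      from this[of m] have "x \<otimes> z [^] m = x" using a(2) xG by simp
      then have "z [^] m = \<one>" using xG zG by simp
      then have "ord z dvd m" using pow_eq_id zG by blast
      moreover obtain n where n: "subgroup P G" "card P = p ^ n" using P by (auto simp: p_subgroup_def)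
      have "z \<in> P" using zN less.prems by blast
      then have "z [^] (p ^ n) = \<one>"
        using group.pow_order_eq_1[OF subgroup_imp_group[OF n(1)], of z] n(2)
        by (simp add: order_def nat_pow_consistent[of z _ P])
      then have "ord z dvd p ^ n" using pow_eq_id zG by blast
      moreover have "coprime m (p ^ n)" using a(3) by simp
      ultimately have "ord z = 1" by (meson coprime_common_divisor_nat)
      then have "z = \<one>" using ord_eq_1 zG by blast
      then show ?thesis using z(2) xG by simp
    qed
    then show ?thesis using aG by (simp add: set_centralizer_def)
  qed
qed

text \<open>Let A be the left side and CV the right side, a subgroup of A. \<open>V\<close> is a
  Sylow p-subgroup of A, and for every other prime q a Sylow q-subgroup of A lies in C by coprime
  action. Hence |A| divides |CV|.\<close>

lemma chief_centralizer_factorization: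
  assumes p: "Factorial_Ring.prime p" and V: "sylow_subgroup p G V"
    and P: "prime_chief_below P" "p_subgroup p G P"
  shows "chief_centralizer G P \<subseteq> set_centralizer G P <#> V"
proof -
  let ?A = "chief_centralizer G P" and ?C = "set_centralizer G P"
  have Pn: "P \<lhd> G" using P by (simp add: prime_chief_below_def)
  have PG: "P \<subseteq> carrier G" using Pn normal_imp_subgroup subgroup.subset by blast
  have An: "?A \<lhd> G" by (rule normal_chief_centralizer)
  then have As: "subgroup ?A G" by (rule normal_imp_subgroup)
  have Vs: "subgroup V G" using V by (simp add: sylow_subgroup_def)
  have VA: "V \<subseteq> ?A"
    using p_subgroup_subset_chief_centralizer[OF p sylow_imp_p_subgroup[OF V] P] .
  have Cn: "?C \<lhd> G" using Pn by (rule normal_set_centralizer)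
  note W = subgroup_normal_mult[OF Cn Vs]
  have CA: "?C \<subseteq> ?A"
  proof
    fix c assume c: "c \<in> ?C"
    have "c \<in> factor_centralizer G H K" if "chief_factor G H K" "H \<subseteq> P" for H K
      using that c PG subgroup.one_closed[of K G] normal_imp_subgroup[of K G]
      by (auto simp: factor_centralizer_def set_centralizer_def chief_factor_def subset_iff)
    then show "c \<in> ?A" using c by (simp add: chief_centralizer_def set_centralizer_def)
  qed
  have WA: "?C <#> V \<subseteq> ?A" using CA VA by (intro set_mult_subset_subgroup As)
  interpret A: finite_group "G\<lparr>carrier := ?A\<rparr>" using As by (rule finite_group_restrict)
  have "q ^ multiplicity q (card ?A) dvd card (?C <#> V)" if q: "Factorial_Ring.prime q" for q
  proof (cases "q = p")
    case True
    have "card V = p ^ multiplicity p (card ?A)"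
      using sylow_inter_normal[OF p An V] VA by (simp add: sylow_subgroup_def order_def Int_absorb2)
    then show ?thesis using card_subgroup_dvd[OF Vs W(1,3)] True by simp
  next
    case False
    obtain Q where Q: "sylow_subgroup q (G\<lparr>carrier := ?A\<rparr>) Q" using A.sylow_exists[OF q] by blast
    then have Qs: "subgroup Q G" and QA: "Q \<subseteq> ?A"
      by (auto simp: sylow_subgroup_def subgroup_restrict_iff[OF As])
    have cQ: "card Q = q ^ multiplicity q (card ?A)" using Q by (simp add: sylow_subgroup_def order_def)
    have "Q \<subseteq> ?C"
    proof
      fix a assume a: "a \<in> Q"
      have "a [^] card Q = \<one>"
        using group.pow_order_eq_1[OF subgroup_imp_group[OF Qs], of a] a
        by (simp add: order_def nat_pow_consistent[of a _ Q])
      moreover have "coprime (card Q) p" using cQ q p False by (simp add: primes_coprime)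
      ultimately show "a \<in> ?C"
        using coprime_chief_centralizer[OF p P(2) _ _ _ Pn] a QA by blast
    qed
    then show ?thesis using card_subgroup_dvd[OF Qs W(1)] W(2) cQ by auto
  qed
  moreover have pos: "0 < card ?A" "0 < card (?C <#> V)" using As W card_subgroup_pos by auto
  ultimately have "card ?A dvd card (?C <#> V)"
    by (intro multiplicity_le_imp_dvd) (auto intro!: multiplicity_geI)
  then have "card ?A \<le> card (?C <#> V)" using pos dvd_imp_le by blast
  then show ?thesis using WA finite_subgroup[OF As] card_seteq by blast
qed

end

section \<open>Control of fusion\<close>

context group
begin

lemma set_normalizer_conjug_image:
  assumes P: "P \<subseteq> carrier G" and h: "h \<in> carrier G"
  shows "set_normalizer G (conjug G h ` P) = conjug G h ` set_normalizer G P"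
proof -
  \<comment> \<open>Stated for arbitrary \<open>P\<close> and \<open>h\<close>, because the reverse
    inclusion is the same claim for P^h and h^-1.\<close>
  have sub: "conjug G h n \<in> set_normalizer G (conjug G h ` P)"
    if n: "n \<in> set_normalizer G P" and P: "P \<subseteq> carrier G" and h: "h \<in> carrier G" for n h P
  proof -
    have nG: "n \<in> carrier G" and nP: "conjug G n ` P = P" using n by (auto simp: set_normalizer_def)
    have "h \<otimes> conjug G h n = n \<otimes> h" using h nG by (simp add: conjug_def flip: m_assoc)
    then have "conjug G (conjug G h n) ` conjug G h ` P = conjug G (n \<otimes> h) ` P"
      using h nG P by (simp flip: conjug_image_mult)
    also have "\<dots> = conjug G h ` P" using h nG P nP by (simp add: conjug_image_mult)
    finally show ?thesis using h nG by (simp add: set_normalizer_def)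
  qed
  have undo: "conjug G (inv h) ` conjug G h ` P = P" using conjug_image_inv[OF h P refl] .
  have hP: "conjug G h ` P \<subseteq> carrier G" using h P by auto
  have "n \<in> conjug G h ` set_normalizer G P" if n: "n \<in> set_normalizer G (conjug G h ` P)" for n
  proof (rule image_eqI)
    show "conjug G (inv h) n \<in> set_normalizer G P"
      using sub[OF n hP inv_closed[OF h]] by (simp only: undo)
    show "n = conjug G h (conjug G (inv h) n)" using n h by (simp add: set_normalizer_def)
  qed
  then show ?thesis using sub[OF _ P h] by blast
qed

end

context finite_group
begin

text \<open>Provides the premise \<open>step\<close> of
  \<open>fusion_controlled_by_normalizer\<close> with U = S \<inter> K, given a suitable
  \<open>K\<close>: it is \<open>frattini_centralizer\<close> inside the normalizer of
  \<open>P\<close>.\<close>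

lemma fully_normalized_step:
  assumes p: "Factorial_Ring.prime p" and S: "subgroup S G" and P: "subgroup P G"
    and V: "sylow_subgroup p (G\<lparr>carrier := set_normalizer G P\<rparr>) (S \<inter> set_normalizer G P)"
    and K: "K \<lhd> G\<lparr>carrier := set_normalizer G P\<rparr>"
    and KC: "K \<subseteq> set_centralizer G P <#> (S \<inter> K)"
    and PK: "P \<subset> S \<inter> K"
  shows "\<exists>U. subgroup U G \<and> P \<subset> U \<and> U \<subseteq> S \<and>
    (\<forall>m\<in>set_normalizer G P. \<exists>c\<in>set_centralizer G P. \<exists>n\<in>set_normalizer G U. m = c \<otimes> n)"
proof -
  define N where "N = set_normalizer G P"
  have PG: "P \<subseteq> carrier G" using P by (rule subgroup.subset)
  have N: "subgroup N G" unfolding N_def using PG by (rule subgroup_set_normalizer)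
  interpret B: finite_group "G\<lparr>carrier := N\<rparr>" using N by (rule finite_group_restrict)
  have Ks: "subgroup K G" "K \<subseteq> N"
    using normal_imp_subgroup[OF K] subgroup_restrict_iff[OF N] by (auto simp: N_def)
  have U: "S \<inter> N \<inter> K = S \<inter> K" using Ks(2) by blast
  have "set_centralizer G P \<subseteq> N" by (auto simp: set_centralizer_def set_normalizer_def N_def)
  then have C: "set_centralizer (G\<lparr>carrier := N\<rparr>) P = set_centralizer G P"
    using set_centralizer_restrict[OF N] by blast
  have PN: "P \<subseteq> carrier (G\<lparr>carrier := N\<rparr>)" using PK Ks(2) by auto
  have "\<exists>c\<in>set_centralizer G P. \<exists>n\<in>set_normalizer G (S \<inter> K). m = c \<otimes> n" if m: "m \<in> N" for m
    using B.frattini_centralizer[OF p K[folded N_def] V[folded N_def] PN, of m] KC m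
    by (auto simp: U C set_normalizer_restrict[OF N])
  moreover have "subgroup (S \<inter> K) G" using S Ks(1) by (rule subgroups_Inter_pair)
  ultimately show ?thesis using PK unfolding N_def by (intro exI[of _ "S \<inter> K"]) blast
qed

text \<open>Only agreement on \<open>P\<close> is asked for, so g and n may differ by a factor
  centralizing \<open>P\<close>.\<close>

definition fusion_controlled :: "'a set \<Rightarrow> 'a set \<Rightarrow> bool"
  where "fusion_controlled S P \<longleftrightarrow> (\<forall>g\<in>carrier G. conjug G g ` P \<subseteq> S \<longrightarrow>
    (\<exists>n\<in>set_normalizer G S. \<forall>x\<in>P. conjug G g x = conjug G n x))"

text \<open>An argument in the style of Alperin's fusion theorem. The premise \<open>step\<close>
  concerns only fully normalized \<open>P\<close>, those whose normalizer in \<open>S\<close> is a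
  Sylow subgroup of their normalizer in \<open>G\<close>; every subgroup of \<open>S\<close> has
  such a conjugate.\<close>

lemma fusion_controlled_by_normalizer:
  assumes p: "Factorial_Ring.prime p" and S: "sylow_subgroup p G S"
    and step: "\<And>P. subgroup P G \<Longrightarrow> P \<subset> S \<Longrightarrow>
      sylow_subgroup p (G\<lparr>carrier := set_normalizer G P\<rparr>) (S \<inter> set_normalizer G P) \<Longrightarrow>
      \<exists>U. subgroup U G \<and> P \<subset> U \<and> U \<subseteq> S \<and>
        (\<forall>m\<in>set_normalizer G P. \<exists>c\<in>set_centralizer G P. \<exists>n\<in>set_normalizer G U. m = c \<otimes> n)"
    and "subgroup P G" "P \<subseteq> S"
  shows "fusion_controlled S P"
  using assms(4,5)
proof (induction "card S - card P" arbitrary: P rule: less_induct)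
  case less
  note P = less.prems(1) and PS = less.prems(2)
  have Ss: "subgroup S G" and Sp: "p_subgroup p G S"
    using S sylow_imp_p_subgroup by (auto simp: sylow_subgroup_def)
  have SG: "S \<subseteq> carrier G" and finS: "finite S"
    using Ss subgroup.subset finite_subgroup by auto
  have PG: "P \<subseteq> carrier G" using PS SG by blast
  define NS where "NS = set_normalizer G S"
  have NS: "subgroup NS G" unfolding NS_def using SG by (rule subgroup_set_normalizer)
  have NSG: "n \<in> carrier G" if "n \<in> NS" for n using that subgroup.mem_carrier[OF NS] by blast
  have NSS: "conjug G n ` Y \<subseteq> S" if "n \<in> NS" "Y \<subseteq> S" for n Y
    using that by (auto simp: NS_def set_normalizer_def)
  have IH: "\<exists>n\<in>NS. \<forall>x\<in>T. conjug G g x = conjug G n x"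
    if T: "subgroup T G" "T \<subseteq> S" "card P < card T" and g: "g \<in> carrier G" "conjug G g ` T \<subseteq> S" for T g
  proof -
    have "card T \<le> card S" using T(2) finS by (rule card_mono[rotated])
    then have "card S - card T < card S - card P" using T(3) by linarith
    then show ?thesis using less.hyps[OF _ T(1,2)] g by (simp add: fusion_controlled_def NS_def)
  qed
  show ?case
  proof (cases "P = S")
    case True
    then show ?thesis
      using card_conjug_image[of _ S] SG card_subset_eq[OF finS]
      unfolding fusion_controlled_def set_normalizer_def by blast
  next
    case False
    then have PS': "P \<subset> S" using PS by blast
    then have cPS: "card P < card S" using finS psubset_card_mono by blast
    define M where "M = set_normalizer G P"
    have M: "subgroup M G" unfolding M_def using PG by (rule subgroup_set_normalizer)
    interpret M: finite_group "G\<lparr>carrier := M\<rparr>" using M by (rule finite_group_restrict)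
    have "p_subgroup p G (S \<inter> M)"
      using p_subgroup_subset[OF p Sp subgroups_Inter_pair[OF Ss M]] by blast
    then have "p_subgroup p (G\<lparr>carrier := M\<rparr>) (S \<inter> M)"
      by (simp add: p_subgroup_restrict_iff[OF M])
    \<comment> \<open>Conjugating by \<open>h\<close> a Sylow subgroup of \<open>M\<close> above
      \<open>S \<inter> M\<close> into \<open>S\<close> makes \<open>R\<close>, the image of
      \<open>P\<close>, fully normalized: the image of \<open>V\<close> is a Sylow subgroup of
      \<open>N\<close> inside \<open>S \<inter> N\<close>.\<close>
    then obtain V where V: "sylow_subgroup p (G\<lparr>carrier := M\<rparr>) V" "S \<inter> M \<subseteq> V"
      using M.sylow_above[OF p] by blast
    then have Vp: "p_subgroup p G V" and VM: "V \<subseteq> M"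
      using M.sylow_imp_p_subgroup p_subgroup_restrict_iff[OF M] by auto
    then obtain h where h: "h \<in> carrier G" "conjug G h ` V \<subseteq> S"
      using sylow_conjug[OF p _ S] by blast
    define R where "R = conjug G h ` P"
    define N where "N = set_normalizer G R"
    have R: "subgroup R G" unfolding R_def using P h(1) by (rule subgroup_conjug_image)
    have RG: "R \<subseteq> carrier G" using R by (rule subgroup.subset)
    have N: "subgroup N G" unfolding N_def using RG by (rule subgroup_set_normalizer)
    have NM: "N = conjug G h ` M"
      unfolding N_def M_def R_def using PG h(1) by (rule set_normalizer_conjug_image)
    have cR: "card R = card P" unfolding R_def using h(1) PG by (rule card_conjug_image)
    have "P \<subseteq> V" using PS V(2) subgroup_subset_set_normalizer[OF P] by (auto simp: M_def)
    then have RS: "R \<subset> S" using h(2) cR cPS by (auto simp: R_def)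
    interpret N: finite_group "G\<lparr>carrier := N\<rparr>" using N by (rule finite_group_restrict)
    have hV: "conjug G h ` V \<subseteq> S \<inter> N" using h(2) VM by (auto simp: NM)
    have SN: "p_subgroup p (G\<lparr>carrier := N\<rparr>) (S \<inter> N)"
      using p_subgroup_subset[OF p Sp subgroups_Inter_pair[OF Ss N]] p_subgroup_restrict_iff[OF N]
      by simp
    have syl: "sylow_subgroup p (G\<lparr>carrier := N\<rparr>) (S \<inter> N)"
    proof -
      have VG: "V \<subseteq> carrier G" using VM subgroup.subset[OF M] by blast
      have "card N = card M"
        unfolding NM using h(1) subgroup.subset[OF M] by (rule card_conjug_image)
      moreover have "subgroup (conjug G h ` V) (G\<lparr>carrier := N\<rparr>)"
        using Vp h(1) hV subgroup_restrict_iff[OF N] by (auto simp: p_subgroup_def subgroup_conjug_image)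
      ultimately have "sylow_subgroup p (G\<lparr>carrier := N\<rparr>) (conjug G h ` V)"
        using V(1) card_conjug_image[OF h(1) VG] by (simp add: sylow_subgroup_def order_def)
      then show ?thesis using N.sylow_maximal[OF p _ SN hV] by simp
    qed
    \<comment> \<open>\<open>R\<close> is a fully normalized conjugate of \<open>P\<close>; moving both \<open>P\<close> and \<open>P\<^sup>g\<close> to \<open>R\<close> by elements
      of \<open>NS\<close> reduces the claim to automorphisms of \<open>R\<close>.\<close>
    have to_R: "\<exists>n\<in>NS. conjug G n ` Q = R"
      if Q: "subgroup Q G" "Q \<subseteq> S" and k: "k \<in> carrier G" "conjug G k ` Q = R" for Q k
    proof -
      have QG: "Q \<subseteq> carrier G" using Q(1) by (rule subgroup.subset)
      \<comment> \<open>The normalizer \<open>T\<close> of \<open>Q\<close> in \<open>S\<close> is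
        larger than \<open>Q\<close>, so the induction hypothesis applies to
        \<open>T\<close>.\<close>
      define T where "T = S \<inter> set_normalizer G Q"
      have T: "subgroup T G" "T \<subseteq> S"
        unfolding T_def using subgroups_Inter_pair[OF Ss subgroup_set_normalizer[OF QG]] by auto
      have TG: "T \<subseteq> carrier G" using T(1) by (rule subgroup.subset)
      have cQ: "card Q = card P" using card_conjug_image[OF k(1) QG] k(2) cR by simp
      then have "Q \<subset> S" using Q(2) cPS by auto
      then have QT: "Q \<subset> T" unfolding T_def by (rule normalizer_grows_in_p_subgroup[OF p Sp Q(1)])
      then have cT: "card P < card T"
        using psubset_card_mono[OF finite_subgroup[OF T(1)]] cQ by metis
      have "N = conjug G k ` set_normalizer G Q"
        unfolding N_def k(2)[symmetric] using QG k(1) by (rule set_normalizer_conjug_image)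
      then have "conjug G k ` T \<subseteq> N" by (auto simp: T_def)
      moreover have "p_subgroup p G (conjug G k ` T)"
        using p_subgroup_conjug_image[OF p_subgroup_subset[OF p Sp T] k(1)] .
      ultimately have "p_subgroup p (G\<lparr>carrier := N\<rparr>) (conjug G k ` T)"
        by (simp add: p_subgroup_restrict_iff[OF N])
      \<comment> \<open>\<open>k\<close> carries \<open>T\<close> into \<open>N\<close> but perhaps
        out of \<open>S\<close>; an element \<open>m\<close> of \<open>N\<close> corrects this and
        leaves \<open>R\<close> in place.\<close>
      from N.sylow_conjug[OF p this syl] obtain m where m: "m \<in> N"
        "conjug (G\<lparr>carrier := N\<rparr>) m ` conjug G k ` T \<subseteq> S \<inter> N" by auto
      have mG: "m \<in> carrier G" using m(1) subgroup.mem_carrier[OF N] by blast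
      have "conjug G (k \<otimes> m) ` T \<subseteq> S"
        using m k(1) mG TG by (simp add: conjug_restrict[OF N] conjug_image_mult)
      then obtain n where n: "n \<in> NS" "\<forall>x\<in>T. conjug G (k \<otimes> m) x = conjug G n x"
        using IH[OF T cT, of "k \<otimes> m"] k(1) mG by auto
      have "conjug G n ` Q = conjug G (k \<otimes> m) ` Q"
        using n(2) QT by (intro image_cong) auto
      also have "\<dots> = conjug G m ` R" using k mG QG by (simp add: conjug_image_mult)
      also have "\<dots> = R" using m(1) by (simp add: N_def set_normalizer_def)
      finally show ?thesis using n(1) by blast
    qed
    obtain U where U: "subgroup U G" "R \<subset> U" "U \<subseteq> S"
      "\<forall>m\<in>N. \<exists>c\<in>set_centralizer G R. \<exists>n\<in>set_normalizer G U. m = c \<otimes> n"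
      using step[OF R RS] syl unfolding N_def by blast
    have cU: "card P < card U"
      using psubset_card_mono[OF finite_subgroup[OF U(1)] U(2)] cR by simp
    \<comment> \<open>\<open>c\<close> acts trivially on \<open>R\<close>, and \<open>n\<close> maps
      the larger group \<open>U\<close> into \<open>S\<close>, so the induction hypothesis applies
      to \<open>n\<close>.\<close>
    have aut: "\<exists>n\<in>NS. \<forall>x\<in>R. conjug G m x = conjug G n x" if m: "m \<in> N" for m
    proof -
      obtain c n where cn: "c \<in> set_centralizer G R" "n \<in> set_normalizer G U" "m = c \<otimes> n"
        using U(4) m by blast
      have cG: "c \<in> carrier G" and nG: "n \<in> carrier G"
        using cn by (auto simp: set_centralizer_def set_normalizer_def)
      have "conjug G n ` U \<subseteq> S" using cn(2) U(3) by (simp add: set_normalizer_def)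
      then obtain n' where n': "n' \<in> NS" "\<forall>x\<in>U. conjug G n x = conjug G n' x"
        using IH[OF U(1,3) cU nG] by blast
      have "conjug G m x = conjug G n' x" if x: "x \<in> R" for x
      proof -
        have "x \<in> carrier G" "x \<in> U" using x RG U(2) by auto
        moreover have "conjug G c x = x" using cn(1) x by (simp add: set_centralizer_def)
        ultimately show ?thesis using cn(3) cG nG n'(2) by (simp add: conjug_mult)
      qed
      then show ?thesis using n'(1) by blast
    qed
    show ?thesis unfolding fusion_controlled_def
    proof (intro ballI impI)
      fix g assume g: "g \<in> carrier G" and gP: "conjug G g ` P \<subseteq> S"
      obtain n1 where n1: "n1 \<in> NS" "conjug G n1 ` P = R"
        using to_R[OF P PS h(1)] by (auto simp: R_def)
      have "conjug G (inv g \<otimes> h) ` conjug G g ` P = R"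
        using g h(1) gP SG conjug_image_inv[OF g PG refl]
        by (simp add: conjug_image_mult R_def)
      then obtain n2 where n2: "n2 \<in> NS" "conjug G n2 ` conjug G g ` P = R"
        using to_R[OF subgroup_conjug_image[OF P g] gP, of "inv g \<otimes> h"] g h(1) by auto
      note car = g NSG[OF n1(1)] NSG[OF n2(1)]
      \<comment> \<open>Going from \<open>R\<close> back to \<open>P\<close>, by \<open>g\<close> to
        P^g and on to \<open>R\<close> gives an element normalizing \<open>R\<close>, which
        \<open>aut\<close> replaces by \<open>n3\<close>. Undoing the outer moves turns
        \<open>g\<close> into n1 n3 n2^-1 on \<open>P\<close>.\<close>
      have "conjug G (inv n1 \<otimes> g \<otimes> n2) ` R = R"
        using car RG PG conjug_image_inv[OF car(2) PG n1(2)] n2(2)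
        by (simp add: conjug_image_mult)
      then have "inv n1 \<otimes> g \<otimes> n2 \<in> N" using car by (simp add: N_def set_normalizer_def)
      then obtain n3 where n3: "n3 \<in> NS"
        "\<forall>x\<in>R. conjug G (inv n1 \<otimes> g \<otimes> n2) x = conjug G n3 x" using aut by blast
      have n3G: "n3 \<in> carrier G" using NSG n3(1) by blast
      have "conjug G g x = conjug G (n1 \<otimes> n3 \<otimes> inv n2) x" if x: "x \<in> P" for x
      proof -
        have xG: "x \<in> carrier G" using x PG by blast
        have "conjug G n1 x \<in> R" using n1(2) x by blast
        then have "conjug G n3 (conjug G n1 x) = conjug G (inv n1 \<otimes> g \<otimes> n2) (conjug G n1 x)"
          using n3(2) by simp
        also have "\<dots> = conjug G n2 (conjug G g x)" using car xG by (simp add: conjug_mult)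
        finally show ?thesis using car n3G xG by (simp add: conjug_mult)
      qed
      moreover have "n1 \<otimes> n3 \<otimes> inv n2 \<in> NS"
        using n1(1) n2(1) n3(1) NS by (simp add: subgroup.m_closed subgroup.m_inv_closed)
      ultimately show "\<exists>n\<in>set_normalizer G S. \<forall>x\<in>P. conjug G g x = conjug G n x"
        unfolding NS_def by blast
    qed
  qed
qed

end

section \<open>Three-eternal relations\<close>

text \<open>Clause (0) carries the relation from \<open>G\<close> down to \<open>M\<close>, where
  clause (3) applies. A non-abelian O_p(M) forces \<open>S\<close> to be non-abelian, so the
  condition on cyclic subgroups of order 4 is inherited too.\<close>

lemma (in finite_group) three_eternal_p_core_subset_hypercenter:
  assumes R: "three_eternal R" and p: "Factorial_Ring.prime p" and M: "subgroup M G"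
    and core: "p_core p (G\<lparr>carrier := M\<rparr>) \<subseteq> S" and S: "subgroup S G"
    and D: "card D = p ^ d" "1 < card D" "card D < card (p_core p (G\<lparr>carrier := M\<rparr>))"
    and RD: "\<And>H. subgroup H (G\<lparr>carrier := S\<rparr>) \<Longrightarrow> card H = card D \<Longrightarrow> R H G"
    and R4: "\<And>H. \<not> comm_group (G\<lparr>carrier := S\<rparr>) \<Longrightarrow> p = 2 \<Longrightarrow>
      cyclic_subgroup (G\<lparr>carrier := S\<rparr>) H \<Longrightarrow> card H = 4 \<Longrightarrow> R H G"
  shows "p_core p (G\<lparr>carrier := M\<rparr>) \<subseteq> supersolvable_hypercenter (G\<lparr>carrier := M\<rparr>)"
proof -
  define K where "K = p_core p (G\<lparr>carrier := M\<rparr>)"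
  interpret M: finite_group "G\<lparr>carrier := M\<rparr>" using M by (rule finite_group_restrict)
  have "p_subgroup p (G\<lparr>carrier := M\<rparr>) K" unfolding K_def by (rule M.p_core(2)[OF p])
  then have KM: "K \<subseteq> M" and "p_subgroup p G K" using p_subgroup_restrict_iff[OF M] by auto
  then obtain k where K: "subgroup K G" and k: "card K = p ^ k" by (auto simp: p_subgroup_def)
  have KS: "K \<subseteq> S" using core by (simp add: K_def)
  have DK: "card D < card K" using D(3) by (simp add: K_def)
  then have dk: "d < k" using k D(1) prime_gt_1_nat[OF p] by (simp add: power_strict_increasing_iff)
  have "p dvd p ^ k" using dk by (cases k) auto
  then have "p dvd order (G\<lparr>carrier := M\<rparr>)"
    using card_subgroup_dvd[OF K M KM] k by (auto simp: order_def intro: dvd_trans)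
  have restrict: "R H (G\<lparr>carrier := M\<rparr>)" if H: "subgroup H G" "H \<subseteq> M" "R H G" for H
    using R that M is_group fin subgroup_restrict_iff[OF M]
    unfolding three_eternal_def by blast
  \<comment> \<open>\<open>D\<close> need not lie in O_p(M), so a subgroup of the same order is
    chosen there, built up from the trivial subgroup of order p^0.\<close>
  obtain D' where D': "subgroup D' G" "D' \<subseteq> K" "card D' = card D"
    using p_subgroup_intermediate[OF p K k triv_subgroup, of 0 d] dk D(1) subgroup.one_closed[OF K]
    by auto
  have SK: "subgroup H (G\<lparr>carrier := S\<rparr>)" if "subgroup H G" "H \<subseteq> K" for H
    using that KS S by (intro subgroup_incl) auto
  have RK: "R H (G\<lparr>carrier := M\<rparr>)" if "subgroup H (G\<lparr>carrier := K\<rparr>)" "card H = card D" for H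
    using that RD[OF SK] restrict[of H] KM by (auto simp: subgroup_restrict_iff[OF K])
  have RK4: "R H (G\<lparr>carrier := M\<rparr>)"
    if nc: "\<not> comm_group (G\<lparr>carrier := K\<rparr>)" and "p = 2"
      and H: "cyclic_subgroup (G\<lparr>carrier := K\<rparr>) H" "card H = 4" for H
  proof -
    have "\<not> comm_group (G\<lparr>carrier := S\<rparr>)"
    proof
      assume "comm_group (G\<lparr>carrier := S\<rparr>)"
      then have "x \<otimes> y = y \<otimes> x" if "x \<in> K" "y \<in> K" for x y
        using that KS comm_group.axioms(1) comm_monoid.m_comm by fastforce
      then have "comm_group (G\<lparr>carrier := K\<rparr>)"
        by (intro group.group_comm_groupI subgroup_imp_group K) simp
      then show False using nc by simp
    qed
    moreover have "subgroup H G" "H \<subseteq> K"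
      using H(1) by (auto simp: cyclic_subgroup_def subgroup_restrict_iff[OF K])
    moreover have "cyclic_subgroup (G\<lparr>carrier := S\<rparr>) H"
      using H(1) calculation(2,3) SK by (simp add: cyclic_subgroup_def)
    ultimately show ?thesis using R4[OF _ \<open>p = 2\<close> _ H(2)] restrict KM by blast
  qed
  \<comment> \<open>The repeated \<open>carrier\<close> update is the literal form of clause (3) for
    the restricted group.\<close>
  have "\<exists>D. subgroup D (G\<lparr>carrier := M, carrier := K\<rparr>) \<and> 1 < card D \<and> card D < card K \<and>
      (\<forall>H. subgroup H (G\<lparr>carrier := M, carrier := K\<rparr>) \<and> card H = card D \<longrightarrow> R H (G\<lparr>carrier := M\<rparr>)) \<and>
      (\<not> comm_group (G\<lparr>carrier := M, carrier := K\<rparr>) \<and> p = 2 \<longrightarrow>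
        (\<forall>H. cyclic_subgroup (G\<lparr>carrier := M, carrier := K\<rparr>) H \<and> card H = 4 \<longrightarrow> R H (G\<lparr>carrier := M\<rparr>)))"
    using D' D(2) DK RK RK4 subgroup_incl[OF D'(1) K D'(2)] by (intro exI[of _ D']) simp
  then show ?thesis
    using R M.is_group M.fin p \<open>p dvd order _\<close>
    unfolding three_eternal_def K_def by blast
qed

theorem theorem3p7:
  fixes R :: "'a set \<Rightarrow> 'a monoid \<Rightarrow> bool"
    and G :: "'a monoid"
    and p :: nat
    and S D :: "'a set"
  assumes "three_eternal R"
    and "group G" and "finite (carrier G)"
    and "Factorial_Ring.prime p" and "p dvd order G"
    and "sylow_subgroup p G S"
    and "subgroup D (G\<lparr>carrier := S\<rparr>)" and "1 < card D" and "card D < card S"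
    and "\<And>H. subgroup H (G\<lparr>carrier := S\<rparr>) \<Longrightarrow> card H = card D \<or> card H = p * card D \<Longrightarrow>
      comm_group (G\<lparr>carrier := H\<rparr>)"
    and "\<And>H. subgroup H (G\<lparr>carrier := S\<rparr>) \<Longrightarrow> card H = card D \<Longrightarrow> R H G"
    and "\<And>H. \<not> comm_group (G\<lparr>carrier := S\<rparr>) \<Longrightarrow> p = 2 \<Longrightarrow>
      cyclic_subgroup (G\<lparr>carrier := S\<rparr>) H \<Longrightarrow> card H = 4 \<Longrightarrow> R H G"
  shows "supersolvable_fusion (G\<lparr>carrier := S\<rparr>) (group_fusion G S)"
proof -
  interpret finite_group G
    using assms(2,3) by (simp add: finite_group_def finite_group_axioms_def)
  note p = assms(4) and syl = assms(6)
  have S: "subgroup S G" and Sp: "p_subgroup p G S"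
    using syl sylow_imp_p_subgroup by (auto simp: sylow_subgroup_def)
  obtain s where s: "card S = p ^ s" using Sp by (auto simp: p_subgroup_def)
  have SG: "S \<subseteq> carrier G" using S by (rule subgroup.subset)
  have D: "subgroup D G" "D \<subseteq> S" using assms(7) subgroup_restrict_iff[OF S] by auto
  obtain d where d: "card D = p ^ d"
    using p_subgroup_subset[OF p Sp D] by (auto simp: p_subgroup_def)
  have p1: "1 < p" using p by (rule prime_gt_1_nat)
  then have ds: "d < s" using assms(9) s d by (simp add: power_strict_increasing_iff)
  \<comment> \<open>Left open are the choice of the subgroup M, the inclusion of O_p(M) in
    \<open>S\<close> and |D| < |O_p(M)|. M will be the normalizer of \<open>P\<close>, and later
    that of \<open>S\<close>.\<close>
  note hyper = three_eternal_p_core_subset_hypercenter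
    [OF assms(1) p _ _ S d assms(8) _ assms(11,12)]
  have step: "\<exists>U. subgroup U G \<and> P \<subset> U \<and> U \<subseteq> S \<and>
      (\<forall>m\<in>set_normalizer G P. \<exists>c\<in>set_centralizer G P. \<exists>n\<in>set_normalizer G U. m = c \<otimes>\<^bsub>G\<^esub> n)"
    if P: "subgroup P G" "P \<subset> S"
      and V: "sylow_subgroup p (G\<lparr>carrier := set_normalizer G P\<rparr>) (S \<inter> set_normalizer G P)" for P
  proof -
    define N where "N = set_normalizer G P"
    have PG: "P \<subseteq> carrier G" using P(1) by (rule subgroup.subset)
    have N: "subgroup N G" unfolding N_def using PG by (rule subgroup_set_normalizer)
    interpret N: finite_group "G\<lparr>carrier := N\<rparr>" using N by (rule finite_group_restrict)
    have Pn: "P \<lhd> G\<lparr>carrier := N\<rparr>" unfolding N_def using P(1) by (rule normal_in_set_normalizer)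
    have PN: "P \<subseteq> N" unfolding N_def using P(1) by (rule subgroup_subset_set_normalizer)
    have Pp: "p_subgroup p G P" using p_subgroup_subset[OF p Sp P(1)] P(2) by blast
    then obtain a where a: "card P = p ^ a" by (auto simp: p_subgroup_def)
    define C where "C = set_centralizer G P"
    have CN: "C \<subseteq> N" by (auto simp: set_centralizer_def set_normalizer_def N_def C_def)
    then have C: "set_centralizer (G\<lparr>carrier := N\<rparr>) P = C"
      unfolding C_def using set_centralizer_restrict[OF N] by blast
    show ?thesis
    proof (cases "card P \<le> card D")
      case True
      have Cn: "C \<lhd> G\<lparr>carrier := N\<rparr>" using N.normal_set_centralizer[OF Pn] by (simp add: C)
      define K where "K = C <#>\<^bsub>G\<^esub> P"
      have K: "K \<lhd> G\<lparr>carrier := N\<rparr>" using N.normal_set_mult[OF Cn Pn] by (simp add: K_def)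
      have CK: "C \<subseteq> K" and PK: "P \<subseteq> K"
        using N.subgroup_normal_mult[OF Cn normal_imp_subgroup[OF Pn]] by (simp_all add: K_def)
      have KC: "K \<subseteq> C <#>\<^bsub>G\<^esub> (S \<inter> K)"
        using P(2) PK unfolding K_def by (intro mono_set_mult) auto
      have "a \<le> d" using True a d p1 by simp
      \<comment> \<open>As \<open>a \<le> d\<close>, the exponents add up to \<open>Suc d\<close>,
        and \<open>d < s\<close> leaves room in \<open>S\<close>. This \<open>U\<close> has order
        p|D|, so it is abelian; containing \<open>P\<close>, it centralizes \<open>P\<close> and
        lies in \<open>S \<inter> K\<close>, which is therefore larger than
        \<open>P\<close>.\<close>
      then obtain U where U: "subgroup U G" "P \<subseteq> U" "U \<subseteq> S" "card U = p * card D"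
        using p_subgroup_intermediate[OF p S s P(1) _ a, of "Suc d - a"] P(2) ds d by auto
      have "comm_group (G\<lparr>carrier := U\<rparr>)" using U S by (intro assms(10) subgroup_incl) auto
      then have comm: "u \<otimes>\<^bsub>G\<^esub> x = x \<otimes>\<^bsub>G\<^esub> u" if "u \<in> U" "x \<in> U" for u x
        using that comm_group.axioms(1) comm_monoid.m_comm by fastforce
      have UC: "U \<subseteq> C"
        using comm U(2) PG subgroup.mem_carrier[OF U(1)]
        by (auto simp: C_def set_centralizer_def conjug_eq_iff subset_iff)
      have "1 * card D < p * card D" using p1 assms(8) by (intro mult_strict_right_mono) auto
      then have "card P < card U" using True U(4) by linarith
      then have "\<not> U \<subseteq> P" using card_mono[OF finite_subgroup[OF P(1)], of U] by linarith
      then have "P \<subset> S \<inter> K" using U(3) UC CK PK P(2) by blast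
      then show ?thesis
        using fully_normalized_step[OF p S P(1) V] K KC by (simp add: N_def C_def)
    next
      case False
      have Vp: "sylow_subgroup p (G\<lparr>carrier := N\<rparr>) (S \<inter> N)" using V by (simp add: N_def)
      have PpN: "p_subgroup p (G\<lparr>carrier := N\<rparr>) P"
        using Pp PN p_subgroup_restrict_iff[OF N] by simp
      let ?O = "p_core p (G\<lparr>carrier := N\<rparr>)"
      note O = N.p_core[OF p]
      \<comment> \<open>O_p(N) contains \<open>P\<close>, so its order exceeds |D|, and it lies in
        the Sylow subgroup \<open>S \<inter> N\<close>; these are the open premises of
        \<open>hyper\<close>.\<close>
      have PO: "P \<subseteq> ?O" using Pn PpN by (rule O(3))
      have OV: "?O \<subseteq> S \<inter> N" using N.normal_p_subgroup_subset_sylow[OF p O(1,2) Vp] .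
      have "finite ?O" using OV finite_subgroup[OF S] finite_subset by blast
      then have "card D < card ?O" using False card_mono[OF _ PO] by linarith
      then have "P \<subseteq> supersolvable_hypercenter (G\<lparr>carrier := N\<rparr>)"
        using hyper[OF N] OV PO by blast
      then have pc: "N.prime_chief_below P" by (rule N.prime_chief_below_hypercenter[OF Pn])
      let ?A = "chief_centralizer (G\<lparr>carrier := N\<rparr>) P"
      have A: "?A \<lhd> G\<lparr>carrier := N\<rparr>" by (rule N.normal_chief_centralizer)
      have AN: "?A \<subseteq> N" by (auto simp: chief_centralizer_def)
      \<comment> \<open>The p-subgroup \<open>S \<inter> N\<close> lies in \<open>?A\<close>, so
        \<open>S \<inter> ?A\<close> is the normalizer of \<open>P\<close> in \<open>S\<close>,
        which is larger than \<open>P\<close>.\<close>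
      have "S \<inter> N \<subseteq> ?A"
        using N.p_subgroup_subset_chief_centralizer[OF p N.sylow_imp_p_subgroup[OF Vp] pc PpN] .
      then have VA: "S \<inter> ?A = S \<inter> N" using AN by blast
      have "?A \<subseteq> C <#>\<^bsub>G\<^esub> (S \<inter> ?A)"
        using N.chief_centralizer_factorization[OF p Vp pc PpN] by (simp add: C VA)
      moreover have "P \<subset> S \<inter> ?A"
        unfolding VA using normalizer_grows_in_p_subgroup[OF p Sp P] by (simp only: N_def)
      ultimately show ?thesis
        using fully_normalized_step[OF p S P(1) V] A by (simp add: N_def C_def)
    qed
  qed
  have control: "fusion_controlled S P" if "subgroup P G" "P \<subseteq> S" for P
    using fusion_controlled_by_normalizer[OF p syl step] that by blast
  \<comment> \<open>Now \<open>N\<close> is the normalizer of \<open>S\<close>. Its p-core is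
    \<open>S\<close>, by normality of \<open>S\<close> in \<open>N\<close> and maximality of a Sylow
    subgroup, so \<open>hyper\<close> applies with |D| < |S|.\<close>
  define N where "N = set_normalizer G S"
  have N: "subgroup N G" unfolding N_def using SG by (rule subgroup_set_normalizer)
  interpret N: finite_group "G\<lparr>carrier := N\<rparr>" using N by (rule finite_group_restrict)
  have Sn: "S \<lhd> G\<lparr>carrier := N\<rparr>" unfolding N_def using S by (rule normal_in_set_normalizer)
  have SN: "S \<subseteq> N" unfolding N_def using S by (rule subgroup_subset_set_normalizer)
  let ?O = "p_core p (G\<lparr>carrier := N\<rparr>)"
  note O = N.p_core[OF p]
  have "S \<subseteq> ?O" using Sn Sp SN p_subgroup_restrict_iff[OF N] by (intro O(3)) auto
  moreover have "p_subgroup p G ?O" using O(2) p_subgroup_restrict_iff[OF N] by blast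
  ultimately have OS: "?O = S" using sylow_maximal[OF p syl] by blast
  have "S \<subseteq> supersolvable_hypercenter (G\<lparr>carrier := N\<rparr>)"
    using hyper[OF N, unfolded OS] assms(9) by blast
  then have pc: "N.prime_chief_below S" by (rule N.prime_chief_below_hypercenter[OF Sn])
  obtain n T where T: "T 0 = {\<one>\<^bsub>G\<^esub>}" "T n = S" "\<And>i. i \<le> n \<Longrightarrow> T i \<lhd> G\<lparr>carrier := N\<rparr>"
    "\<And>i. i < n \<Longrightarrow> chief_factor (G\<lparr>carrier := N\<rparr>) (T (Suc i)) (T i)"
    using N.chief_series_exists[OF Sn] by auto
  have sub: "T i \<subseteq> T (Suc i)" if "i < n" for i using T(4)[OF that] by (auto simp: chief_factor_def)
  have TS: "T i \<subseteq> S" if "i \<le> n" for i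
    using that
  proof (induction rule: inc_induct)
    case base
    then show ?case using T(2) by simp
  next
    case (step i)
    then show ?case using sub[of i] by blast
  qed
  \<comment> \<open>A morphism from \<open>P\<close> below \<open>T i\<close> is conjugation by some
    \<open>g\<close>; by control it agrees on \<open>P\<close> with conjugation by an element of
    \<open>N\<close>, which preserves \<open>T i\<close>.\<close>
  have "strongly_closed (G\<lparr>carrier := S\<rparr>) (group_fusion G S) (T i)" if i: "i \<le> n" for i
  proof -
    have Ti: "subgroup (T i) G"
      using normal_imp_subgroup[OF T(3)[OF i]] subgroup_restrict_iff[OF N] by blast
    have "\<phi> ` P \<subseteq> T i" if P: "subgroup P (G\<lparr>carrier := T i\<rparr>)" and \<phi>: "\<phi> \<in> group_fusion G S P S" for P \<phi>
    proof -
      have P': "subgroup P G" "P \<subseteq> T i" using P subgroup_restrict_iff[OF Ti] by auto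
      obtain g where g: "g \<in> carrier G" "\<phi> = restrict (conjug G g) P" "\<phi> ` P \<subseteq> S"
        using \<phi> unfolding group_fusion_def conjug_def by blast
      have "fusion_controlled S P" using control P' TS[OF i] by blast
      then obtain m where m: "m \<in> N" "\<And>x. x \<in> P \<Longrightarrow> conjug G g x = conjug G m x"
        using g unfolding fusion_controlled_def N_def by auto
      have "conjug G m x \<in> T i" if "x \<in> P" for x
        using T(3)[OF i] m(1) that P'(2)
        by (auto simp: N.normal_iff_conjug conjug_restrict[OF N])
      then show ?thesis using g(2) m(2) by auto
    qed
    then show ?thesis
      using subgroup_incl[OF Ti S TS[OF i]] by (simp add: strongly_closed_def)
  qed
  moreover have "cyclic_group ((G\<lparr>carrier := T (Suc i)\<rparr>) Mod T i)" if i: "i < n" for i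
    using N.chief_factor_prime_index_iff_cyclic[OF T(4)[OF i]] pc T(4)[OF i] TS[of "Suc i"] i
    by (auto simp: N.prime_chief_below_def)
  ultimately show ?thesis
    unfolding supersolvable_fusion_def using T(1,2) sub
    by (intro exI[of _ n] exI[of _ T]) simp
qed

end
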